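(* Consider the online knapsack problem with unknown reward distributions in the full feedback setting, and assume that the reward distributions are sub-Gaussian and that $\delta:=\min_{j\ne j'}\left|\mathbb E[R_j]/w_j-\mathbb E[R_{j'}]/w_{j'}\right|>0$. Let $v^{\mathrm{off}}$ be the expected total reward of the Offline controller and $v^{\mathrm{on}}$ the expected total reward of the Learning RABBI policy (both defined in the context). Then the policy obtains regret that depends only on the primitives $(n,\mathbf p,\mathbf r,\mathbf w,\delta)$ and is independent of the horizon length $T$ and the knapsack capacity $B$; that is, there is a constant $M$ depending only on $(n,\mathbf p,\mathbf r,\mathbf w,\delta)$ such that for all $T$ and $B$, $$\mathbb E[\mathrm{Regret}]:=v^{\mathrm{off}}-v^{\mathrm{on}}\le M.$$
   Context: **Problem.** Periods are $t=T,T-1,\dots,1$ ($t$ is the time-to-go); the initial knapsack capacity is $B\ge 0$. In each period an item arrives whose type $\xi^t\in[n]$ is drawn i.i.d. from a known distribution $\mathbf p=(p_1,\dots,p_n)$. Type $j$ has a known weight $w_j>0$ and a random reward $R_j\sim F_j$ with mean $r_j=\mathbb E[R_j]$, drawn independently for each arrival; $\mathbf w=(w_j)$, $\mathbf r=(r_j)$. The distributions $F_j$ and means $r_j$ are unknown to the online controller, which also does not know $\delta$. Upon seeing the type $j$, the controller accepts (it then collects the random reward and the capacity is reduced by $w_j$) or rejects (collecting $0$). Decisions of every controller must satisfy the capacity constraint: accepting a type-$j$ item is a feasible action only if the remaining capacity is at least $w_j$. The reward is revealed only after the accept/reject decision. *Full feedback*: at the end of each period the realized reward of the arriving item is observed whether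 it was accepted or rejected. Before the process starts the online controller is also given one independent sample of the reward of each type. *Sub-Gaussian* means that the rewards satisfy the following tail bound: for every $j$, $N\ge1$ and $x\ge0$, the average of $N$ i.i.d. copies of $R_j$ exceeds $r_j$ by at least $x$ with probability at most $e^{-Nx^2/2}$, and falls below $r_j$ by at least $x$ with probability at most $e^{-Nx^2/2}$. **Offline controller.** Offline knows all arrival types $\xi^T,\dots,\xi^1$ in advance and the reward distributions $F_j$ (hence the means $r_j$ and the ranking of the ratios $r_j/w_j$), but not the future reward realizations; it plays an optimal policy for this information. $v^{\mathrm{off}}$ is its expected total reward. **LP.** For $(b,\mathbf y,\mathbf z)\in\mathbb R_{\ge0}\times\mathbb R^n\times\mathbb R^n_{\ge0}$, $P[b,\mathbf y,\mathbf z]$ is the linear program in variables $x_{j\mathtt a},x_{j\mathtt r}\ge0$: maximize $\sum_jy_jx_{j\mathtt a}$ subject to $\sum_jw_jx_{j\mathtt a}\le b$ and $x_{j\mathtt a}+x_{j\mathtt r}=z_j$ for all $j\in[n]$. **Learning RABBI policy.** Put $B^T=B$. In each period $t=T,\dots,1$, let $R^t_j$ be the empirical average of all rewards of type $j$ observed so far (including the initial sample), and $R^t=(R^t_j)_j$. Compute an optimal solution $X^t$ of $P[B^t,R^t,t\mathbf p]$ (here $t\mathbf p$ is the vector of expected numbers of arrivals of each type in the last $t$ periods). Observe the arriving type $j$ and take any action in $\operatorname{argmax}_{u=\mathtt a,\mathtt r}X^t_{j,u}$ ($\mathtt a$ = accept, $\mathtt r$ = reject). If the action is accept, collect the random reward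 $R_j$ and set $B^{t-1}=B^t-w_j$; otherwise set $B^{t-1}=B^t$. Update the empirical averages with the observed reward. *)

theory Defs
  imports "HOL-Probability.Probability"
begin

datatype action = Accept | Reject

subsection \<open>Primitives\<close>

text \<open>The infimum is taken in the extended reals, so that it is \<open>\<infinity>\<close> (hence positive) when there is
  only one type.\<close>

definition ratio_gap :: "('n::finite \<Rightarrow> real) \<Rightarrow> ('n \<Rightarrow> real) \<Rightarrow> ereal" where
  "ratio_gap r w = (INF (j, j') \<in> {(j, j'). j \<noteq> j'}. ereal \<bar>r j / w j - r j' / w j'\<bar>)"

definition sub_gaussian :: "real measure \<Rightarrow> real \<Rightarrow> bool" where
  "sub_gaussian D \<mu> \<longleftrightarrow> (\<forall>N\<ge>1. \<forall>x\<ge>0.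
     (let P = PiM {..<N} (\<lambda>_. D) in
       measure P {Y \<in> space P. (\<Sum>i<N. Y i) / real N \<ge> \<mu> + x} \<le> exp (- (real N * x\<^sup>2 / 2)) \<and>
       measure P {Y \<in> space P. (\<Sum>i<N. Y i) / real N \<le> \<mu> - x} \<le> exp (- (real N * x\<^sup>2 / 2))))"

definition reward_distributions :: "('n::finite \<Rightarrow> real) \<Rightarrow> ('n \<Rightarrow> real measure) \<Rightarrow> bool" where
  "reward_distributions r F \<longleftrightarrow> (\<forall>j.
     prob_space (F j) \<and> sets (F j) = sets borel \<and>
     integrable (F j) (\<lambda>x. x) \<and> integral\<^sup>L (F j) (\<lambda>x. x) = r j \<and>
     sub_gaussian (F j) (r j))"

subsection \<open>Outcomes\<close>

text \<open>An outcome consists of the initial sample of each type, the arriving types, and a table of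
  rewards. Time is time-to-go, so the periods \<open>{1..T}\<close> are run through downwards. Entry \<open>(t, j)\<close> of
  the table is the reward which the item of period \<open>t\<close> yields if it is of type \<open>j\<close>; only the entry
  at the arriving type is ever collected or observed.\<close>

type_synonym 'n outcome = "('n \<Rightarrow> real) \<times> (nat \<Rightarrow> 'n) \<times> (nat \<Rightarrow> 'n \<Rightarrow> real)"

definition outcome_space :: "'n::finite pmf \<Rightarrow> ('n \<Rightarrow> real measure) \<Rightarrow> nat \<Rightarrow> 'n outcome measure" where
  "outcome_space p F T =
     PiM UNIV F \<Otimes>\<^sub>M PiM {1..T} (\<lambda>_. measure_pmf p) \<Otimes>\<^sub>M PiM {1..T} (\<lambda>_. PiM UNIV F)"

definition initial_sample :: "'n outcome \<Rightarrow> 'n \<Rightarrow> real" where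
  "initial_sample \<omega> = fst \<omega>"

definition arrival :: "'n outcome \<Rightarrow> nat \<Rightarrow> 'n" where
  "arrival \<omega> t = fst (snd \<omega>) t"

definition reward :: "'n outcome \<Rightarrow> nat \<Rightarrow> real" where
  "reward \<omega> t = snd (snd \<omega>) t (arrival \<omega> t)"

subsection \<open>Decisions\<close>

definition capacity ::
  "('n \<Rightarrow> real) \<Rightarrow> nat \<Rightarrow> real \<Rightarrow> (nat \<Rightarrow> 'n outcome \<Rightarrow> action) \<Rightarrow> nat \<Rightarrow> 'n outcome \<Rightarrow> real" where
  "capacity w T B d t \<omega> = B - (\<Sum>s | s \<in> {t<..T} \<and> d s \<omega> = Accept. w (arrival \<omega> s))"

definition feasible_actions ::
  "('n \<Rightarrow> real) \<Rightarrow> nat \<Rightarrow> real \<Rightarrow> (nat \<Rightarrow> 'n outcome \<Rightarrow> action) \<Rightarrow> nat \<Rightarrow> 'n outcome \<Rightarrow> action set" where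
  "feasible_actions w T B d t \<omega> =
     {u. u = Accept \<longrightarrow> w (arrival \<omega> t) \<le> capacity w T B d t \<omega>}"

definition expected_reward ::
  "'n::finite pmf \<Rightarrow> ('n \<Rightarrow> real measure) \<Rightarrow> nat \<Rightarrow> (nat \<Rightarrow> 'n outcome \<Rightarrow> action) \<Rightarrow> real" where
  "expected_reward p F T d =
     (\<integral>\<omega>. (\<Sum>t=1..T. if d t \<omega> = Accept then reward \<omega> t else 0) \<partial>outcome_space p F T)"

text \<open>The arrivals of the periods in \<open>A\<close> together with the rewards of the items arriving in the
  periods in \<open>S\<close>. Policies below are functions of such data, which makes them non-anticipating.
  Under full feedback the rewards of rejected items are observed as well, so that the available data
  do not depend on the actions.\<close>

type_synonym 'n data = "(nat \<Rightarrow> 'n) \<times> (nat \<Rightarrow> real)"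

definition observed :: "nat set \<Rightarrow> nat set \<Rightarrow> 'n outcome \<Rightarrow> 'n data" where
  "observed A S \<omega> = (restrict (arrival \<omega>) A, restrict (reward \<omega>) S)"

definition data_space :: "nat set \<Rightarrow> nat set \<Rightarrow> 'n data measure" where
  "data_space A S = PiM A (\<lambda>_. count_space UNIV) \<Otimes>\<^sub>M PiM S (\<lambda>_. borel)"

subsection \<open>The Offline controller\<close>

text \<open>In period \<open>t\<close> Offline knows all arrivals and the rewards of the periods before \<open>t\<close>.\<close>

type_synonym 'n offline_policy = "nat \<Rightarrow> 'n data \<Rightarrow> action"

definition offline_decision ::
  "nat \<Rightarrow> 'n offline_policy \<Rightarrow> nat \<Rightarrow> 'n outcome \<Rightarrow> action" where
  "offline_decision T \<pi> t \<omega> = \<pi> t (observed {1..T} {t<..T} \<omega>)"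

definition offline_policies ::
  "('n::finite \<Rightarrow> real) \<Rightarrow> nat \<Rightarrow> real \<Rightarrow> 'n offline_policy set" where
  "offline_policies w T B = {\<pi>. \<forall>t\<in>{1..T}.
     \<pi> t \<in> measurable (data_space {1..T} {t<..T}) (count_space UNIV) \<and>
     (\<forall>\<omega>. offline_decision T \<pi> t \<omega> \<in> feasible_actions w T B (offline_decision T \<pi>) t \<omega>)}"

definition v_off ::
  "'n::finite pmf \<Rightarrow> ('n \<Rightarrow> real) \<Rightarrow> ('n \<Rightarrow> real measure) \<Rightarrow> nat \<Rightarrow> real \<Rightarrow> real" where
  "v_off p w F T B =
     (SUP \<pi> \<in> offline_policies w T B. expected_reward p F T (offline_decision T \<pi>))"

subsection \<open>The linear program\<close>

definition lp_feasible ::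
  "('n::finite \<Rightarrow> real) \<Rightarrow> real \<Rightarrow> ('n \<Rightarrow> real) \<Rightarrow> ('n \<Rightarrow> action \<Rightarrow> real) \<Rightarrow> bool" where
  "lp_feasible w b z x \<longleftrightarrow>
     (\<forall>j u. 0 \<le> x j u) \<and> (\<Sum>j\<in>UNIV. w j * x j Accept) \<le> b \<and>
     (\<forall>j. x j Accept + x j Reject = z j)"

definition lp_optimal ::
  "('n::finite \<Rightarrow> real) \<Rightarrow> real \<Rightarrow> ('n \<Rightarrow> real) \<Rightarrow> ('n \<Rightarrow> real) \<Rightarrow> ('n \<Rightarrow> action \<Rightarrow> real) \<Rightarrow> bool" where
  "lp_optimal w b y z x \<longleftrightarrow>
     is_arg_max (\<lambda>x. \<Sum>j\<in>UNIV. y j * x j Accept) (lp_feasible w b z) x"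

subsection \<open>The Learning RABBI policy\<close>

text \<open>In period \<open>t\<close> an online policy sees the initial sample, the arrivals up to and including
  period \<open>t\<close>, and the rewards of the periods before \<open>t\<close>.\<close>

type_synonym 'n online_policy = "nat \<Rightarrow> ('n \<Rightarrow> real) \<times> 'n data \<Rightarrow> action"

definition online_decision ::
  "nat \<Rightarrow> 'n online_policy \<Rightarrow> nat \<Rightarrow> 'n outcome \<Rightarrow> action" where
  "online_decision T \<pi> t \<omega> = \<pi> t (initial_sample \<omega>, observed {t..T} {t<..T} \<omega>)"

definition empirical_average :: "nat \<Rightarrow> nat \<Rightarrow> 'n outcome \<Rightarrow> 'n \<Rightarrow> real" where
  "empirical_average T t \<omega> j =
     (let S = {s \<in> {t<..T}. arrival \<omega> s = j}
      in (initial_sample \<omega> j + (\<Sum>s\<in>S. reward \<omega> s)) / (1 + real (card S)))"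

text \<open>The choice \<open>X\<close> among the optimal solutions is arbitrary, but made before the arriving type is
  seen; ties between the actions are broken arbitrarily. The arg max ranges over the feasible actions
  only: near the end of the horizon an optimal solution may favour accepting an item that no longer
  fits, and then the item has to be rejected.\<close>

definition learning_rabbi ::
  "'n::finite pmf \<Rightarrow> ('n \<Rightarrow> real) \<Rightarrow> nat \<Rightarrow> real \<Rightarrow> 'n online_policy \<Rightarrow> bool" where
  "learning_rabbi p w T B \<pi> \<longleftrightarrow>
     (\<forall>t\<in>{1..T}. \<pi> t \<in> measurable
        (PiM UNIV (\<lambda>_. borel) \<Otimes>\<^sub>M data_space {t..T} {t<..T}) (count_space UNIV)) \<and>
     (\<exists>X :: nat \<Rightarrow> ('n \<Rightarrow> real) \<times> 'n data \<Rightarrow> 'n \<Rightarrow> action \<Rightarrow> real.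
        \<forall>t\<in>{1..T}. \<forall>\<omega>.
          let d = online_decision T \<pi>;
              x = X t (initial_sample \<omega>, observed {t<..T} {t<..T} \<omega>)
          in lp_optimal w (capacity w T B d t \<omega>) (empirical_average T t \<omega>)
               (\<lambda>j. real t * pmf p j) x \<and>
             is_arg_max (x (arrival \<omega> t)) (\<lambda>u. u \<in> feasible_actions w T B d t \<omega>) (d t \<omega>))"

definition v_on ::
  "'n::finite pmf \<Rightarrow> ('n \<Rightarrow> real measure) \<Rightarrow> nat \<Rightarrow> 'n online_policy \<Rightarrow> real" where
  "v_on p F T \<pi> = expected_reward p F T (online_decision T \<pi>)"

end

theory Submission
  imports Defs
begin

text \<open>
  Since an item's reward is independent of everything known when the decision is taken, both
  controllers collect, in expectation, the mean rewards \<open>r\<close> of the items they accept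
  (\<open>expected_reward_eq_mean\<close>). It therefore suffices to compare, outcome by outcome, sums of mean
  rewards, and Offline's sum is at most the value of the fractional knapsack problem with the actual
  arrivals. By linear programming duality that value is at most \<open>\<theta> * b\<close> plus the sum of
  \<open>max 0 (r j - \<theta> * w j)\<close> over the arriving items, for every price \<open>\<theta> \<ge> 0\<close> of a unit of capacity,
  and for \<open>b \<ge> 0\<close> the best price is \<open>0\<close> or one of the ratios \<open>r j / w j\<close>. The minimum
  over these finitely many prices, called \<open>relaxation\<close>, serves as a potential: it bounds
  Offline's remaining value and is at most zero when no item is left.

  Follow the potential along the decisions of the online policy. If an item of type \<open>j\<close> is accepted,
  potential plus collected mean reward does not drop provided that an optimal price after the
  acceptance can be chosen not above \<open>r j / w j\<close>, which holds if \<open>r j \<ge> 0\<close> and all later items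
  with a strictly better ratio still fit (\<open>accept_without_loss\<close>). If it is rejected, nothing is lost provided that an
  optimal price can be chosen at least \<open>r j / w j\<close>, which holds if \<open>r j \<le> 0\<close> or the later items
  with a ratio at least as good fill the remaining capacity (\<open>reject_without_loss\<close>). In any other case the loss is
  at most the constant \<open>max_loss\<close>. So the regret is at most \<open>max_loss\<close> times the expected number of
  periods in which these conditions fail (\<open>relaxation_le_collected\<close>).

  The policy accepts a type only if at least half of its expected remaining arrivals are accepted in
  the linear program, and rejects a fitting type only if at least half of them are rejected. If the
  estimates rank the ratios correctly and have the right signs, exchange arguments for optimal
  solutions turn this into the two conditions with a margin of \<open>t * pmf p j * w j / 2\<close>,
  linear in the time-to-go \<open>t\<close> (\<open>rabbi_accept_leaves_room\<close>,
  \<open>rabbi_reject_is_tight\<close>). Hence they can fail only if \<open>t\<close> is below a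
  constant, or the weight arriving in the last \<open>t\<close> periods deviates from its mean by a
  fixed fraction of \<open>t\<close>, or the estimate for some type in the support of
  \<open>p\<close> is off by a fixed \<open>\<eta>\<close>. The second event has probability
  exponentially small in \<open>t\<close> by Hoeffding's inequality (\<open>load_deviation\<close>).
  The third has probability exponentially small in the number \<open>T - t\<close> of periods
  already observed, since the number of observations of each type that occurs grows linearly
  (\<open>estimate_deviation\<close>). The geometric series in \<open>t\<close> and in \<open>T -
  t\<close> are bounded independently of \<open>T\<close>, and \<open>B\<close> never enters.
\<close>

section \<open>Exchange arguments for the linear program\<close>

text \<open>The rejected amounts are determined by the accepted ones, so an optimal solution can be compared with any
  vector of accepted amounts; the exchange arguments below perturb one or two of its entries.\<close>

lemma lp_optimal_ge:
  assumes "lp_optimal w b y z x"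
    and "\<And>j. 0 \<le> v j" "\<And>j. v j \<le> z j" "(\<Sum>j\<in>UNIV. w j * v j) \<le> b"
  shows "(\<Sum>j\<in>UNIV. y j * v j) \<le> (\<Sum>j\<in>UNIV. y j * x j Accept)"
proof -
  let ?x = "\<lambda>j u. case u of Accept \<Rightarrow> v j | Reject \<Rightarrow> z j - v j"
  have "lp_feasible w b z ?x"
    using assms(2-4) by (auto simp: lp_feasible_def split: action.split)
  then show ?thesis
    using assms(1) by (fastforce simp: lp_optimal_def is_arg_max_linorder)
qed

lemma lp_optimal_bounds:
  assumes "lp_optimal w b y z x"
  shows "0 \<le> x j Accept" "0 \<le> x j Reject" "x j Accept + x j Reject = z j"
    "(\<Sum>j\<in>UNIV. w j * x j Accept) \<le> b"
  using assms by (auto simp: lp_optimal_def is_arg_max_def lp_feasible_def)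

text \<open>Otherwise a little capacity could be moved from type \<open>j\<close> to the more valuable type
  \<open>i\<close>.\<close>

lemma lp_optimal_saturates_better:
  fixes w :: "'n::finite \<Rightarrow> real"
  assumes opt: "lp_optimal w b y z x" and w: "\<And>j. 0 < w j"
    and pos: "0 < x j Accept" and better: "y j / w j < y i / w i"
  shows "x i Accept = z i"
proof (rule ccontr)
  note bounds = lp_optimal_bounds[OF opt]
  assume "x i Accept \<noteq> z i"
  then have less: "x i Accept < z i" using bounds(2,3)[of i] by linarith
  have "i \<noteq> j" using better by auto
  \<comment> \<open>The amount of capacity that can be moved from type \<open>j\<close> to type
    \<open>i\<close>.\<close>
  define e where "e = min (w i * (z i - x i Accept)) (w j * x j Accept)"
  have "0 < e" using w[of i] w[of j] less pos by (simp add: e_def)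
  have e1: "e / w i \<le> z i - x i Accept" "e / w j \<le> x j Accept"
    using w[of i] w[of j] by (auto simp: e_def field_simps min_le_iff_disj)
  define v where "v k = x k Accept + (if k = i then e / w i else 0) - (if k = j then e / w j else 0)" for k
  have sum_v: "(\<Sum>k\<in>UNIV. c k * v k) = (\<Sum>k\<in>UNIV. c k * x k Accept) + c i * (e / w i) - c j * (e / w j)" for c
  proof -
    have "c k * v k = c k * x k Accept + (if k = i then c i * (e / w i) else 0)
        - (if k = j then c j * (e / w j) else 0)" for k
      by (simp add: v_def right_diff_distrib distrib_left)
    then show ?thesis by (simp add: sum.distrib sum_subtractf)
  qed
  have "(\<Sum>k\<in>UNIV. y k * v k) \<le> (\<Sum>k\<in>UNIV. y k * x k Accept)"
  proof (rule lp_optimal_ge[OF opt])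
    show "0 \<le> v k" for k using e1 \<open>0 < e\<close> w[of i] bounds(1)[of k] \<open>i \<noteq> j\<close> by (auto simp: v_def)
    show "v k \<le> z k" for k
      using e1 divide_pos_pos[OF \<open>0 < e\<close> w[of j]] bounds(2,3)[of k] \<open>i \<noteq> j\<close> by (auto simp: v_def)
    have "w i \<noteq> 0" "w j \<noteq> 0" using w[of i] w[of j] by auto
    then show "(\<Sum>k\<in>UNIV. w k * v k) \<le> b" using bounds(4) by (simp add: sum_v)
  qed
  then have "y i / w i * e \<le> y j / w j * e" by (simp add: sum_v)
  then show False using mult_strict_right_mono[OF better \<open>0 < e\<close>] by linarith
qed

text \<open>Otherwise accepting nothing of type \<open>j\<close> would be better.\<close>

lemma lp_optimal_nonneg:
  fixes w :: "'n::finite \<Rightarrow> real"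
  assumes opt: "lp_optimal w b y z x" and w: "\<And>j. 0 < w j" and pos: "0 < x j Accept"
  shows "0 \<le> y j"
proof -
  note bounds = lp_optimal_bounds[OF opt]
  define v where "v k = x k Accept - (if k = j then x j Accept else 0)" for k
  have sum_v: "(\<Sum>k\<in>UNIV. c k * v k) = (\<Sum>k\<in>UNIV. c k * x k Accept) - c j * x j Accept" for c
  proof -
    have "c k * v k = c k * x k Accept - (if k = j then c j * x j Accept else 0)" for k
      by (simp add: v_def right_diff_distrib)
    then show ?thesis by (simp add: sum_subtractf)
  qed
  have "(\<Sum>k\<in>UNIV. y k * v k) \<le> (\<Sum>k\<in>UNIV. y k * x k Accept)"
  proof (rule lp_optimal_ge[OF opt])
    show "0 \<le> v k" "v k \<le> z k" for k using bounds(1-3)[of k] by (auto simp: v_def)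
    have "0 < w j * x j Accept" using w[of j] pos by simp
    then show "(\<Sum>k\<in>UNIV. w k * v k) \<le> b" using bounds(4) by (simp add: sum_v)
  qed
  then show ?thesis using pos by (simp add: sum_v zero_le_mult_iff)
qed

text \<open>Otherwise the spare capacity could be used for more of type \<open>j\<close>.\<close>

lemma lp_optimal_exhausts:
  fixes w :: "'n::finite \<Rightarrow> real"
  assumes opt: "lp_optimal w b y z x" and w: "\<And>j. 0 < w j"
    and less: "x j Accept < z j" and pos: "0 < y j"
  shows "(\<Sum>j\<in>UNIV. w j * x j Accept) = b"
proof (rule ccontr)
  note bounds = lp_optimal_bounds[OF opt]
  assume "(\<Sum>j\<in>UNIV. w j * x j Accept) \<noteq> b"
  then have slack: "(\<Sum>j\<in>UNIV. w j * x j Accept) < b" using bounds(4) by linarith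
  define e where "e = min (z j - x j Accept) ((b - (\<Sum>j\<in>UNIV. w j * x j Accept)) / w j)"
  have "0 < e" using less slack w[of j] by (simp add: e_def)
  have e1: "e \<le> z j - x j Accept" by (simp add: e_def)
  have "e \<le> (b - (\<Sum>j\<in>UNIV. w j * x j Accept)) / w j" by (simp add: e_def)
  then have e2: "w j * e \<le> b - (\<Sum>j\<in>UNIV. w j * x j Accept)"
    using w[of j] by (simp add: pos_le_divide_eq mult.commute)
  define v where "v k = x k Accept + (if k = j then e else 0)" for k
  have sum_v: "(\<Sum>k\<in>UNIV. c k * v k) = (\<Sum>k\<in>UNIV. c k * x k Accept) + c j * e" for c
  proof -
    have "c k * v k = c k * x k Accept + (if k = j then c j * e else 0)" for k
      by (simp add: v_def distrib_left)
    then show ?thesis by (simp add: sum.distrib)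
  qed
  have "(\<Sum>k\<in>UNIV. y k * v k) \<le> (\<Sum>k\<in>UNIV. y k * x k Accept)"
  proof (rule lp_optimal_ge[OF opt])
    show "0 \<le> v k" "v k \<le> z k" for k using bounds(1-3)[of k] e1 \<open>0 < e\<close> by (auto simp: v_def)
    show "(\<Sum>k\<in>UNIV. w k * v k) \<le> b" using e2 by (simp add: sum_v)
  qed
  then have "y j * e \<le> 0" by (simp add: sum_v)
  then show False using pos \<open>0 < e\<close> by (simp add: mult_le_0_iff)
qed

section \<open>A dual potential for the knapsack problem\<close>

definition excess :: "('n \<Rightarrow> real) \<Rightarrow> ('n \<Rightarrow> real) \<Rightarrow> real \<Rightarrow> 'n \<Rightarrow> real" where
  "excess r w \<theta> j = max 0 (r j - \<theta> * w j)"

text \<open>The Lagrangian bound on the value of the items arriving in the periods \<open>t, \<dots>, 1\<close> when a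
  unit of capacity costs \<open>\<theta>\<close>.\<close>

definition priced_value ::
  "('n \<Rightarrow> real) \<Rightarrow> ('n \<Rightarrow> real) \<Rightarrow> real \<Rightarrow> (nat \<Rightarrow> 'n) \<Rightarrow> nat \<Rightarrow> real \<Rightarrow> real" where
  "priced_value r w b a t \<theta> = \<theta> * b + (\<Sum>s=1..t. excess r w \<theta> (a s))"

text \<open>The bound is piecewise linear in the price, with kinks at the ratios, so with a nonnegative capacity these
  prices suffice for its minimum over \<open>\<theta> \<ge> 0\<close>.\<close>

definition prices :: "('n::finite \<Rightarrow> real) \<Rightarrow> ('n \<Rightarrow> real) \<Rightarrow> real set" where
  "prices r w = insert 0 (range (\<lambda>j. max 0 (r j / w j)))"

definition relaxation ::
  "('n::finite \<Rightarrow> real) \<Rightarrow> ('n \<Rightarrow> real) \<Rightarrow> real \<Rightarrow> (nat \<Rightarrow> 'n) \<Rightarrow> nat \<Rightarrow> real" where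
  "relaxation r w b a t = Min (priced_value r w b a t ` prices r w)"

definition load :: "('n \<Rightarrow> real) \<Rightarrow> 'n set \<Rightarrow> (nat \<Rightarrow> 'n) \<Rightarrow> nat \<Rightarrow> real" where
  "load w A a t = (\<Sum>s=1..t. if a s \<in> A then w (a s) else 0)"

definition better :: "('n \<Rightarrow> real) \<Rightarrow> ('n \<Rightarrow> real) \<Rightarrow> 'n \<Rightarrow> 'n set" where
  "better r w j = {i. r j / w j < r i / w i}"

definition at_least_as_good :: "('n \<Rightarrow> real) \<Rightarrow> ('n \<Rightarrow> real) \<Rightarrow> 'n \<Rightarrow> 'n set" where
  "at_least_as_good r w j = {i. r j / w j \<le> r i / w i}"

text \<open>A crude bound on what a single wrong decision can cost: the reward of the item, plus the value of its
  capacity at the highest price.\<close>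

definition max_loss :: "('n::finite \<Rightarrow> real) \<Rightarrow> ('n \<Rightarrow> real) \<Rightarrow> real" where
  "max_loss r w = (\<Sum>j\<in>UNIV. \<bar>r j\<bar>) + Max (prices r w) * (\<Sum>j\<in>UNIV. w j)"

context
  fixes r w :: "'n::finite \<Rightarrow> real"
  assumes w: "\<And>j. 0 < w j"
begin

lemma finite_prices: "finite (prices r w)" and prices_nonempty: "prices r w \<noteq> {}"
  by (simp_all add: prices_def)

lemma prices_nonneg: "\<theta> \<in> prices r w \<Longrightarrow> 0 \<le> \<theta>"
  by (auto simp: prices_def)

lemma relaxation_le: "\<theta> \<in> prices r w \<Longrightarrow> relaxation r w b a t \<le> priced_value r w b a t \<theta>"
  unfolding relaxation_def by (intro Min_le finite_imageI finite_prices) auto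

lemma relaxation_attained:
  obtains \<theta> where "\<theta> \<in> prices r w" "relaxation r w b a t = priced_value r w b a t \<theta>"
proof -
  have "relaxation r w b a t \<in> priced_value r w b a t ` prices r w"
    unfolding relaxation_def by (intro Min_in) (auto simp: finite_prices prices_nonempty)
  then show ?thesis using that by auto
qed

lemma relaxation_0: "relaxation r w b a 0 \<le> 0"
  using relaxation_le[of 0 b a 0] by (simp add: prices_def priced_value_def)

lemma priced_value_Suc:
  "priced_value r w b a (Suc t) \<theta> = priced_value r w b a t \<theta> + excess r w \<theta> (a (Suc t))"
  by (simp add: priced_value_def)

text \<open>Raising the price from \<open>r j / w j\<close> to \<open>\<theta>\<close> lowers the excess of an item at
  rate at most its weight, and only if its ratio beats that of \<open>j\<close>.\<close>

lemma excess_price_mono_better: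
  assumes "r j / w j \<le> \<theta>"
  shows "excess r w (r j / w j) i
    \<le> excess r w \<theta> i + (\<theta> - r j / w j) * (if i \<in> better r w j then w i else 0)"
proof (cases "i \<in> better r w j")
  case True
  have "r j / w j * w i \<le> \<theta> * w i" using assms w[of i] by (intro mult_right_mono) auto
  moreover have "r j / w j * w i < r i" using True w[of i] by (simp add: better_def pos_less_divide_eq)
  ultimately show ?thesis using True by (auto simp: excess_def left_diff_distrib max_def)
next
  case False
  then have "r i \<le> r j / w j * w i" using w[of i] by (simp add: better_def not_less pos_divide_le_eq)
  then show ?thesis using False by (simp add: excess_def)
qed

text \<open>Lowering the price from \<open>r j / w j\<close> to \<open>\<theta>\<close> raises the excess of every
  item at least as good as \<open>j\<close> at a rate equal to its weight.\<close>

lemma excess_price_antimono_worse: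
  assumes "\<theta> \<le> r j / w j"
  shows "excess r w (r j / w j) i + (r j / w j - \<theta>) * (if i \<in> at_least_as_good r w j then w i else 0)
    \<le> excess r w \<theta> i"
proof (cases "i \<in> at_least_as_good r w j")
  case True
  then have "r j / w j * w i \<le> r i" using w[of i] by (simp add: at_least_as_good_def pos_le_divide_eq)
  moreover have "\<theta> * w i \<le> r j / w j * w i" using assms w[of i] by (intro mult_right_mono) auto
  ultimately show ?thesis using True by (auto simp: excess_def left_diff_distrib max_def)
next
  case False
  have "\<theta> * w i \<le> r j / w j * w i" using assms w[of i] by (intro mult_right_mono) auto
  then show ?thesis using False by (auto simp: excess_def max_def)
qed

text \<open>While the capacity exceeds the load of the better types, the bound is nondecreasing in the price beyond
  \<open>r j / w j\<close>, so higher prices need not be considered.\<close>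

lemma price_above_ratio:
  assumes "r j / w j \<le> \<theta>" and "load w (better r w j) a t \<le> b"
  shows "priced_value r w b a t (r j / w j) \<le> priced_value r w b a t \<theta>"
proof -
  let ?\<rho> = "r j / w j"
  have "(\<Sum>s=1..t. excess r w ?\<rho> (a s)) \<le> (\<Sum>s=1..t. excess r w \<theta> (a s)
      + (\<theta> - ?\<rho>) * (if a s \<in> better r w j then w (a s) else 0))"
    by (intro sum_mono excess_price_mono_better assms)
  also have "\<dots> = (\<Sum>s=1..t. excess r w \<theta> (a s)) + (\<theta> - ?\<rho>) * load w (better r w j) a t"
    by (simp only: sum.distrib sum_distrib_left load_def)
  also have "(\<theta> - ?\<rho>) * load w (better r w j) a t \<le> (\<theta> - ?\<rho>) * b"
    using assms by (intro mult_left_mono) auto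
  finally show ?thesis by (simp add: priced_value_def algebra_simps)
qed

text \<open>The mirror image: while the types at least as good fill the capacity, the bound is nonincreasing in the
  price up to \<open>r j / w j\<close>.\<close>

lemma price_below_ratio:
  assumes "\<theta> \<le> r j / w j" and "b \<le> load w (at_least_as_good r w j) a t"
  shows "priced_value r w b a t (r j / w j) \<le> priced_value r w b a t \<theta>"
proof -
  let ?\<rho> = "r j / w j" and ?G = "at_least_as_good r w j"
  have "(\<Sum>s=1..t. excess r w ?\<rho> (a s)) + (?\<rho> - \<theta>) * b
      \<le> (\<Sum>s=1..t. excess r w ?\<rho> (a s)) + (?\<rho> - \<theta>) * load w ?G a t"
    using assms by (intro add_left_mono mult_left_mono) auto
  also have "\<dots> = (\<Sum>s=1..t. excess r w ?\<rho> (a s)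
      + (?\<rho> - \<theta>) * (if a s \<in> ?G then w (a s) else 0))"
    by (simp only: sum.distrib sum_distrib_left load_def)
  also have "\<dots> \<le> (\<Sum>s=1..t. excess r w \<theta> (a s))"
    by (intro sum_mono excess_price_antimono_worse assms)
  finally show ?thesis by (simp add: priced_value_def algebra_simps)
qed

text \<open>At a price of at most \<open>r j / w j\<close> the excess of the item and the cost of its capacity add up
  to exactly \<open>r j\<close>, so it remains to see that such a price is optimal afterwards.\<close>

lemma accept_without_loss:
  assumes j: "a (Suc t) = j" and "0 \<le> r j"
    and room: "load w (better r w j) a t \<le> b - w j"
  shows "relaxation r w b a (Suc t) \<le> r j + relaxation r w (b - w j) a t"
proof -
  obtain \<theta> where \<theta>: "\<theta> \<in> prices r w" "relaxation r w (b - w j) a t = priced_value r w (b - w j) a t \<theta>"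
    by (rule relaxation_attained)
  define \<mu> where "\<mu> = min \<theta> (r j / w j)"
  have "0 \<le> r j / w j" using \<open>0 \<le> r j\<close> w[of j] by simp
  then have "r j / w j = max 0 (r j / w j)" by simp
  then have "r j / w j \<in> prices r w" unfolding prices_def by blast
  then have \<mu>: "\<mu> \<in> prices r w" using \<theta> by (simp add: \<mu>_def min_def)
  have "\<mu> * w j \<le> r j" using w[of j] by (simp add: \<mu>_def pos_le_divide_eq[symmetric])
  then have "priced_value r w b a (Suc t) \<mu> = r j + priced_value r w (b - w j) a t \<mu>"
    by (simp add: priced_value_Suc j excess_def) (simp add: priced_value_def algebra_simps)
  also have "priced_value r w (b - w j) a t \<mu> \<le> priced_value r w (b - w j) a t \<theta>"
    using price_above_ratio[OF _ room] by (auto simp: \<mu>_def min_def)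
  finally show ?thesis using relaxation_le[OF \<mu>, of b a "Suc t"] \<theta> by simp
qed

text \<open>At a price of at least \<open>r j / w j\<close> the item has no excess, so it remains to see that such a
  price is optimal afterwards. For \<open>r j \<le> 0\<close> every nonnegative price qualifies.\<close>

lemma reject_without_loss:
  assumes j: "a (Suc t) = j"
    and tight: "r j \<le> 0 \<or> b \<le> load w (at_least_as_good r w j) a t"
  shows "relaxation r w b a (Suc t) \<le> relaxation r w b a t"
proof -
  obtain \<theta> where \<theta>: "\<theta> \<in> prices r w" "relaxation r w b a t = priced_value r w b a t \<theta>"
    by (rule relaxation_attained)
  define \<mu> where "\<mu> = max \<theta> (r j / w j)"
  have "0 \<le> \<theta>" using \<theta>(1) by (rule prices_nonneg)
  have \<mu>: "\<mu> \<in> prices r w"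
  proof (cases "\<theta> \<le> r j / w j")
    case True
    then have "\<mu> = max 0 (r j / w j)" using \<open>0 \<le> \<theta>\<close> by (simp add: \<mu>_def)
    then show ?thesis unfolding prices_def by blast
  qed (use \<theta> in \<open>simp add: \<mu>_def\<close>)
  have "r j \<le> \<mu> * w j" using w[of j] by (simp add: \<mu>_def pos_divide_le_eq[symmetric])
  then have "priced_value r w b a (Suc t) \<mu> = priced_value r w b a t \<mu>"
    by (simp add: priced_value_Suc j excess_def)
  also have "priced_value r w b a t \<mu> \<le> priced_value r w b a t \<theta>"
  proof (cases "\<theta> < r j / w j")
    case True
    then have "0 < r j / w j" using \<open>0 \<le> \<theta>\<close> by linarith
    then have "\<not> r j \<le> 0" using w[of j] by (auto simp: zero_less_divide_iff)
    then show ?thesis using price_below_ratio[of \<theta> j b a t] True tight by (simp add: \<mu>_def)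
  qed (simp add: \<mu>_def max_def)
  finally show ?thesis using relaxation_le[OF \<mu>, of b a "Suc t"] \<theta> by simp
qed

lemma max_loss_bounds:
  shows "\<theta> \<in> prices r w \<Longrightarrow> \<bar>r j\<bar> + \<theta> * w j \<le> max_loss r w" and "\<bar>r j\<bar> \<le> max_loss r w"
proof -
  show *: "\<bar>r j\<bar> + \<theta> * w j \<le> max_loss r w" if "\<theta> \<in> prices r w" for \<theta>
  proof -
    have "\<theta> \<le> Max (prices r w)" using finite_prices that by (rule Max_ge)
    moreover have "w j \<le> (\<Sum>j\<in>UNIV. w j)" "\<bar>r j\<bar> \<le> (\<Sum>j\<in>UNIV. \<bar>r j\<bar>)"
      using less_imp_le[OF w] by (auto intro!: member_le_sum)
    ultimately show ?thesis
      unfolding max_loss_def using prices_nonneg[OF that] less_imp_le[OF w]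
      by (intro add_mono mult_mono) auto
  qed
  show "\<bar>r j\<bar> \<le> max_loss r w" using *[of 0] by (simp add: prices_def)
qed

lemma accept_loss_le:
  assumes j: "a (Suc t) = j"
  shows "relaxation r w b a (Suc t) \<le> r j + relaxation r w (b - w j) a t + max_loss r w"
proof -
  obtain \<theta> where \<theta>: "\<theta> \<in> prices r w" "relaxation r w (b - w j) a t = priced_value r w (b - w j) a t \<theta>"
    by (rule relaxation_attained)
  have "0 \<le> \<theta> * w j" using prices_nonneg[OF \<theta>(1)] w[of j] by simp
  have "relaxation r w b a (Suc t) \<le> priced_value r w b a (Suc t) \<theta>" using \<theta>(1) by (rule relaxation_le)
  also have "\<dots> \<le> r j + priced_value r w (b - w j) a t \<theta> + max_loss r w"
    using max_loss_bounds(1)[OF \<theta>(1), of j] \<open>0 \<le> \<theta> * w j\<close>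
    unfolding priced_value_Suc j by (auto simp: priced_value_def excess_def algebra_simps max_def)
  finally show ?thesis using \<theta> by simp
qed

lemma reject_loss_le:
  assumes j: "a (Suc t) = j"
  shows "relaxation r w b a (Suc t) \<le> relaxation r w b a t + max_loss r w"
proof -
  obtain \<theta> where \<theta>: "\<theta> \<in> prices r w" "relaxation r w b a t = priced_value r w b a t \<theta>"
    by (rule relaxation_attained)
  have "0 \<le> \<theta> * w j" using prices_nonneg[OF \<theta>(1)] w[of j] by simp
  have "relaxation r w b a (Suc t) \<le> priced_value r w b a (Suc t) \<theta>" using \<theta>(1) by (rule relaxation_le)
  also have "\<dots> \<le> priced_value r w b a t \<theta> + max_loss r w"
    using max_loss_bounds(2)[of j] \<open>0 \<le> \<theta> * w j\<close>
    unfolding priced_value_Suc j by (auto simp: excess_def max_def)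
  finally show ?thesis using \<theta> by simp
qed

text \<open>Weak duality, at the price that attains the minimum.\<close>

lemma collected_le_relaxation:
  assumes budget: "(\<Sum>t | t \<in> {1..T} \<and> t \<in> A. w (a t)) \<le> B"
  shows "(\<Sum>t=1..T. if t \<in> A then r (a t) else 0) \<le> relaxation r w B a T"
proof -
  obtain \<theta> where \<theta>: "\<theta> \<in> prices r w" "relaxation r w B a T = priced_value r w B a T \<theta>"
    by (rule relaxation_attained)
  have "(\<Sum>t=1..T. if t \<in> A then r (a t) else 0)
      \<le> (\<Sum>t=1..T. \<theta> * (if t \<in> A then w (a t) else 0) + excess r w \<theta> (a t))"
    by (intro sum_mono) (auto simp: excess_def)
  also have "\<dots> = \<theta> * (\<Sum>t=1..T. if t \<in> A then w (a t) else 0) + (\<Sum>t=1..T. excess r w \<theta> (a t))"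
    by (simp add: sum.distrib sum_distrib_left)
  also have "(\<Sum>t=1..T. if t \<in> A then w (a t) else 0) = (\<Sum>t | t \<in> {1..T} \<and> t \<in> A. w (a t))"
    by (rule sum.inter_filter[symmetric]) simp
  also have "\<theta> * (\<Sum>t | t \<in> {1..T} \<and> t \<in> A. w (a t)) \<le> \<theta> * B"
    using budget prices_nonneg[OF \<theta>(1)] by (rule mult_left_mono)
  finally show ?thesis by (simp add: \<theta> priced_value_def)
qed

text \<open>The potential argument. \<open>A\<close> is the set of periods with an acceptance, \<open>c t\<close> the
  capacity left when \<open>t\<close> periods remain, and \<open>Bad\<close> contains all periods whose decision might
  lose value.\<close>

lemma relaxation_le_collected:
  assumes step: "\<And>t. t < T \<Longrightarrow> c t = c (Suc t) - (if Suc t \<in> A then w (a (Suc t)) else 0)"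
    and acc: "\<And>t. t < T \<Longrightarrow> Suc t \<in> A \<Longrightarrow> Suc t \<notin> Bad \<Longrightarrow>
       0 \<le> r (a (Suc t)) \<and> load w (better r w (a (Suc t))) a t \<le> c t"
    and rej: "\<And>t. t < T \<Longrightarrow> Suc t \<notin> A \<Longrightarrow> Suc t \<notin> Bad \<Longrightarrow>
       r (a (Suc t)) \<le> 0 \<or> c t \<le> load w (at_least_as_good r w (a (Suc t))) a t"
  shows "relaxation r w (c T) a T
    \<le> (\<Sum>t=1..T. if t \<in> A then r (a t) else 0) + max_loss r w * (\<Sum>t=1..T. of_bool (t \<in> Bad))"
proof -
  have "u \<le> T \<Longrightarrow> relaxation r w (c u) a u
    \<le> (\<Sum>t=1..u. if t \<in> A then r (a t) else 0) + max_loss r w * (\<Sum>t=1..u. of_bool (t \<in> Bad))" for u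
  proof (induction u)
    case 0
    then show ?case using relaxation_0 by simp
  next
    case (Suc u)
    let ?j = "a (Suc u)"
    have "relaxation r w (c (Suc u)) a (Suc u) \<le> relaxation r w (c u) a u
      + (if Suc u \<in> A then r ?j else 0) + max_loss r w * of_bool (Suc u \<in> Bad)"
    proof (cases "Suc u \<in> A")
      case True
      have "c u = c (Suc u) - w ?j" using step[of u] Suc.prems True by simp
      then show ?thesis
        using accept_without_loss[OF refl, of a u "c (Suc u)"] accept_loss_le[OF refl, of "c (Suc u)" a u]
          acc[of u] True Suc.prems
        by (cases "Suc u \<in> Bad") auto
    next
      case False
      have "c u = c (Suc u)" using step[of u] Suc.prems False by simp
      then show ?thesis
        using reject_without_loss[OF refl, of a u "c (Suc u)"] reject_loss_le[OF refl, of "c (Suc u)" a u]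
          rej[of u] False Suc.prems
        by (cases "Suc u \<in> Bad") auto
    qed
    then show ?case using Suc by (simp add: algebra_simps)
  qed
  then show ?thesis by simp
qed

end

section \<open>Decisions of the policy in typical periods\<close>

definition mean_load :: "'n::finite pmf \<Rightarrow> ('n \<Rightarrow> real) \<Rightarrow> 'n set \<Rightarrow> real" where
  "mean_load p w A = (\<Sum>i\<in>A. pmf p i * w i)"

text \<open>The precision \<open>\<eta>\<close> is fine enough for estimates to get all strict comparisons of ratios
  and all signs right.\<close>

definition resolves :: "('n \<Rightarrow> real) \<Rightarrow> ('n \<Rightarrow> real) \<Rightarrow> real \<Rightarrow> bool" where
  "resolves r w \<eta> \<longleftrightarrow> 0 < \<eta> \<and> (\<forall>y i j. \<bar>y i - r i\<bar> < \<eta> \<longrightarrow> \<bar>y j - r j\<bar> < \<eta> \<longrightarrow>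
     (r j / w j < r i / w i \<longrightarrow> y j / w j < y i / w i) \<and>
     (0 < r j \<longrightarrow> 0 < y j) \<and> (r j < 0 \<longrightarrow> y j < 0))"

text \<open>There are finitely many strict inequalities, each of which survives small perturbations.\<close>

lemma resolves_exists:
  fixes r w :: "'n::finite \<Rightarrow> real"
  assumes w: "\<And>j. 0 < w j"
  shows "\<exists>\<eta>. resolves r w \<eta>"
proof -
  have small: "\<forall>\<^sub>F \<eta> in at_right 0. \<eta> < c" if "0 < c" for c :: real
    using that by (intro eventually_at_right_real[THEN eventually_mono]) auto
  have "\<forall>\<^sub>F \<eta> in at_right 0. \<forall>j. r j \<noteq> 0 \<longrightarrow> \<eta> < \<bar>r j\<bar>"
    by (intro eventually_all_finite) (auto intro!: eventually_mono[OF small])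
  moreover have "\<forall>\<^sub>F \<eta> in at_right 0. \<forall>i j. r j / w j < r i / w i \<longrightarrow>
      \<eta> < (r i / w i - r j / w j) / (1 / w i + 1 / w j)"
  proof (intro eventually_all_finite)
    fix i j
    show "\<forall>\<^sub>F \<eta> in at_right 0. r j / w j < r i / w i \<longrightarrow>
      \<eta> < (r i / w i - r j / w j) / (1 / w i + 1 / w j)"
    proof (cases "r j / w j < r i / w i")
      case True
      then have "0 < (r i / w i - r j / w j) / (1 / w i + 1 / w j)"
        using w[of i] w[of j] by (intro divide_pos_pos add_pos_pos) auto
      from small[OF this] show ?thesis by (rule eventually_mono) simp
    qed simp
  qed
  moreover have "\<forall>\<^sub>F \<eta> in at_right 0. 0 < (\<eta>::real)" by (rule eventually_at_right_less)
  ultimately have "\<forall>\<^sub>F \<eta> in at_right 0. resolves r w \<eta>"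
  proof eventually_elim
    case (elim \<eta>)
    have "y j / w j < y i / w i"
      if "\<bar>y i - r i\<bar> < \<eta>" "\<bar>y j - r j\<bar> < \<eta>" "r j / w j < r i / w i" for y i j
    proof -
      have "0 < 1 / w i + 1 / w j" using w[of i] w[of j] by (intro add_pos_pos) auto
      then have "\<eta> * (1 / w i + 1 / w j) < r i / w i - r j / w j"
        using elim(2)[rule_format, OF that(3)] pos_less_divide_eq by blast
      then have "\<eta> / w i + \<eta> / w j < r i / w i - r j / w j" by (simp add: algebra_simps)
      moreover have "(r i - y i) / w i < \<eta> / w i" "(y j - r j) / w j < \<eta> / w j"
        using that w[of i] w[of j] by (auto intro!: divide_strict_right_mono)
      ultimately show ?thesis by (simp add: diff_divide_distrib)
    qed
    moreover have "(0 < r j \<longrightarrow> 0 < y j) \<and> (r j < 0 \<longrightarrow> y j < 0)" if "\<bar>y j - r j\<bar> < \<eta>" for y j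
      using that elim(1)[rule_format, of j] by (auto simp: abs_if split: if_splits)
    ultimately show ?case using elim(3) unfolding resolves_def by blast
  qed
  then show ?thesis by (rule eventually_happens'[OF trivial_limit_at_right_real])
qed

lemma load_Suc: "load w A a (Suc t) = load w A a t + (if a (Suc t) \<in> A then w (a (Suc t)) else 0)"
  by (simp add: load_def)

text \<open>A typical period \<open>Suc t\<close>: the arriving type has positive probability, the horizon is long enough
  for the margin \<open>Suc t * pmf p j * w j / 2\<close> to cover the deviation \<open>\<epsilon> * Suc t\<close> of a load and the
  weight of one item, and the estimates \<open>y\<close> are accurate on the support of \<open>p\<close>. Types outside the
  support may be misjudged, but the linear program expects no arrivals of them.\<close>

context
  fixes p :: "'n::finite pmf" and r w :: "'n \<Rightarrow> real" and \<eta> \<epsilon> :: real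
    and a :: "nat \<Rightarrow> 'n" and t :: nat and y :: "'n \<Rightarrow> real" and x :: "'n \<Rightarrow> action \<Rightarrow> real" and b :: real
  assumes w: "\<And>j. 0 < w j"
    and \<eta>: "resolves r w \<eta>"
    and arrives: "a (Suc t) \<in> set_pmf p"
    and margin: "\<epsilon> \<le> w (a (Suc t)) * pmf p (a (Suc t)) / 4" "4 \<le> real (Suc t) * pmf p (a (Suc t))"
    and est: "\<And>i. i \<in> set_pmf p \<Longrightarrow> \<bar>y i - r i\<bar> < \<eta>"
    and opt: "lp_optimal w b y (\<lambda>i. real (Suc t) * pmf p i) x"
begin

lemma margin_covers_deviation: "\<epsilon> * real (Suc t) + w (a (Suc t)) \<le> w (a (Suc t)) * (real (Suc t) * pmf p (a (Suc t)) / 2)"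
proof -
  let ?j = "a (Suc t)"
  have "\<epsilon> * real (Suc t) \<le> w ?j * pmf p ?j / 4 * real (Suc t)" using margin(1) by (rule mult_right_mono) simp
  moreover have "4 * w ?j \<le> real (Suc t) * pmf p ?j * w ?j"
    using margin(2) less_imp_le[OF w] by (rule mult_right_mono)
  ultimately show ?thesis by (simp add: field_simps)
qed

text \<open>The solution accepts all expected arrivals of the better types before it spends \<open>Suc t * pmf p j * w
  j / 2\<close> or more on type \<open>j\<close> itself; the latter is more than the actual load can exceed its mean,
  plus the weight of the arriving item.\<close>

lemma rabbi_accept_leaves_room:
  assumes "x (a (Suc t)) Reject \<le> x (a (Suc t)) Accept"
    and load: "load w (better r w (a (Suc t))) a (Suc t)
      \<le> real (Suc t) * mean_load p w (better r w (a (Suc t))) + \<epsilon> * real (Suc t)"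
  shows "0 \<le> r (a (Suc t))"
    and "load w (better r w (a (Suc t))) a t \<le> b - w (a (Suc t))"
proof -
  let ?j = "a (Suc t)" and ?G = "better r w (a (Suc t))"
  note bounds = lp_optimal_bounds[OF opt]
  have half: "real (Suc t) * pmf p ?j / 2 \<le> x ?j Accept" using assms(1) bounds(3)[of ?j] by linarith
  then have pos: "0 < x ?j Accept" using margin(2) by linarith
  have "0 \<le> y ?j" using opt w pos by (rule lp_optimal_nonneg)
  then show "0 \<le> r ?j" using \<eta> est[OF arrives] unfolding resolves_def by (meson not_le)
  have sat: "x i Accept = real (Suc t) * pmf p i" if "i \<in> ?G" for i
  proof (cases "i \<in> set_pmf p")
    case True
    then have "y ?j / w ?j < y i / w i"
      using \<eta> est[OF arrives] est[OF True] that unfolding resolves_def better_def by blast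
    then show ?thesis by (rule lp_optimal_saturates_better[where w = w and j = ?j and y = y, OF opt w pos])
  next
    case False
    then have "pmf p i = 0" by (simp add: set_pmf_eq)
    then show ?thesis using bounds(1-3)[of i] by simp
  qed
  have "?j \<notin> ?G" by (simp add: better_def)
  have "real (Suc t) * mean_load p w ?G + w ?j * x ?j Accept = (\<Sum>i\<in>insert ?j ?G. w i * x i Accept)"
    using \<open>?j \<notin> ?G\<close> by (simp add: mean_load_def sum_distrib_left sat mult_ac)
  also have "\<dots> \<le> (\<Sum>i\<in>UNIV. w i * x i Accept)"
    using less_imp_le[OF w] bounds(1) by (intro sum_mono2) auto
  also have "\<dots> \<le> b" by (rule bounds)
  finally have "real (Suc t) * mean_load p w ?G + w ?j * x ?j Accept \<le> b" .
  moreover have "w ?j * (real (Suc t) * pmf p ?j / 2) \<le> w ?j * x ?j Accept"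
    using half less_imp_le[OF w] by (rule mult_left_mono)
  ultimately show "load w ?G a t \<le> b - w ?j"
    using load[unfolded load_Suc] margin_covers_deviation \<open>?j \<notin> ?G\<close> by (simp only: if_False)
qed

text \<open>If \<open>r j > 0\<close>, a solution that leaves half of type \<open>j\<close> unserved exhausts the
  capacity and spends none of it on worse types. The expected load of the types at least as good then exceeds the
  capacity by the unserved half, which covers the deviation of the actual load and the weight of the arriving item. If
  the item was rejected only because it does not fit, the typical load of its own type alone already exceeds the
  capacity.\<close>

lemma rabbi_reject_is_tight:
  assumes "w (a (Suc t)) \<le> b \<Longrightarrow> x (a (Suc t)) Accept \<le> x (a (Suc t)) Reject"
    and load: "real (Suc t) * mean_load p w (at_least_as_good r w (a (Suc t))) - \<epsilon> * real (Suc t)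
      \<le> load w (at_least_as_good r w (a (Suc t))) a (Suc t)"
  shows "r (a (Suc t)) \<le> 0 \<or> b \<le> load w (at_least_as_good r w (a (Suc t))) a t"
proof (rule disjCI)
  let ?j = "a (Suc t)" and ?G = "at_least_as_good r w (a (Suc t))"
  note bounds = lp_optimal_bounds[OF opt]
  assume "\<not> b \<le> load w ?G a t"
  then have less: "load w ?G a t < b" by simp
  have "?j \<in> ?G" by (simp add: at_least_as_good_def)
  have load': "real (Suc t) * mean_load p w ?G - \<epsilon> * real (Suc t) - w ?j \<le> load w ?G a t"
    using load \<open>?j \<in> ?G\<close> by (simp add: load_Suc)
  have mean: "pmf p ?j * w ?j \<le> mean_load p w ?G"
    unfolding mean_load_def using \<open>?j \<in> ?G\<close> less_imp_le[OF w] by (intro member_le_sum) auto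
  show "r ?j \<le> 0"
  proof (rule ccontr)
    assume "\<not> r ?j \<le> 0"
    then have "0 < r ?j" by simp
    \<comment> \<open>The expected load of type \<open>j\<close> alone is at least four times \<open>w
      j\<close>, so a capacity above the actual load admits the item.\<close>
    have "w ?j \<le> b"
    proof -
      have "real (Suc t) * (pmf p ?j * w ?j) \<le> real (Suc t) * mean_load p w ?G"
        using mean by (rule mult_left_mono) simp
      then have "w ?j * (real (Suc t) * pmf p ?j) \<le> real (Suc t) * mean_load p w ?G"
        by (simp only: mult_ac)
      moreover have "w ?j * 4 \<le> w ?j * (real (Suc t) * pmf p ?j)"
        using margin(2) less_imp_le[OF w] by (rule mult_left_mono)
      moreover have "w ?j * (real (Suc t) * pmf p ?j / 2) = w ?j * (real (Suc t) * pmf p ?j) / 2"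
        by simp
      ultimately show ?thesis using less load' margin_covers_deviation w[of ?j] by linarith
    qed
    then have "x ?j Accept \<le> x ?j Reject" by (rule assms)
    then have half: "x ?j Accept \<le> real (Suc t) * pmf p ?j / 2" using bounds(3)[of ?j] by linarith
    then have "x ?j Accept < real (Suc t) * pmf p ?j" using margin(2) by linarith
    have "0 < y ?j" using \<open>0 < r ?j\<close> \<eta> est[OF arrives] unfolding resolves_def by blast
    have zero: "x i Accept = 0" if "i \<notin> ?G" for i
    proof (rule ccontr)
      assume "x i Accept \<noteq> 0"
      then have pos: "0 < x i Accept" using bounds(1)[of i] by linarith
      have "i \<in> set_pmf p"
      proof (rule ccontr)
        assume "i \<notin> set_pmf p"
        then have "pmf p i = 0" by (simp add: set_pmf_eq)
        then show False using pos bounds(2,3)[of i] by simp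
      qed
      then have "y i / w i < y ?j / w ?j"
        using \<eta> est[OF arrives] est[of i] that unfolding resolves_def at_least_as_good_def
        by (simp add: not_le)
      then have "x ?j Accept = real (Suc t) * pmf p ?j"
        by (rule lp_optimal_saturates_better[where w = w and j = i and y = y, OF opt w pos])
      then show False using \<open>x ?j Accept < real (Suc t) * pmf p ?j\<close> by simp
    qed
    have "b = (\<Sum>i\<in>UNIV. w i * x i Accept)"
      using lp_optimal_exhausts[where j = ?j and w = w and y = y, OF opt w _ \<open>0 < y ?j\<close>] \<open>x ?j Accept < real (Suc t) * pmf p ?j\<close>
      by simp
    also have "\<dots> = (\<Sum>i\<in>?G. w i * x i Accept)"
      by (rule sum.mono_neutral_right) (auto simp: zero)
    also have "\<dots> = w ?j * x ?j Accept + (\<Sum>i\<in>?G - {?j}. w i * x i Accept)"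
      using \<open>?j \<in> ?G\<close> by (simp add: sum.remove)
    also have "(\<Sum>i\<in>?G - {?j}. w i * x i Accept) \<le> (\<Sum>i\<in>?G - {?j}. w i * (real (Suc t) * pmf p i))"
    proof (intro sum_mono mult_left_mono)
      show "x i Accept \<le> real (Suc t) * pmf p i" for i using bounds(2,3)[of i] by linarith
      show "0 \<le> w i" for i using w[of i] by simp
    qed
    also have "\<dots> = (\<Sum>i\<in>?G. w i * (real (Suc t) * pmf p i)) - w ?j * (real (Suc t) * pmf p ?j)"
      using \<open>?j \<in> ?G\<close> by (simp add: sum_diff1)
    also have "(\<Sum>i\<in>?G. w i * (real (Suc t) * pmf p i)) = real (Suc t) * mean_load p w ?G"
      by (simp add: mean_load_def sum_distrib_left mult_ac)
    finally have "b \<le> w ?j * x ?j Accept + (real (Suc t) * mean_load p w ?G - w ?j * (real (Suc t) * pmf p ?j))"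
      by simp
    moreover have "w ?j * x ?j Accept \<le> w ?j * (real (Suc t) * pmf p ?j / 2)"
      using half less_imp_le[OF w] by (rule mult_left_mono)
    moreover have "w ?j * (real (Suc t) * pmf p ?j / 2) = w ?j * (real (Suc t) * pmf p ?j) / 2"
      by simp
    ultimately show False using less load' margin_covers_deviation by linarith
  qed
qed

end

section \<open>Concentration and unseen rewards\<close>

lemma distr_pair_snd:
  assumes "prob_space N" "prob_space M"
  shows "distr (N \<Otimes>\<^sub>M M) M snd = M"
proof (rule measure_eqI)
  interpret N: prob_space N by fact
  interpret M: prob_space M by fact
  fix A assume "A \<in> sets (distr (N \<Otimes>\<^sub>M M) M snd)"
  then have A: "A \<in> sets M" by simp
  have "snd -` A \<inter> space (N \<Otimes>\<^sub>M M) = space N \<times> A"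
    using sets.sets_into_space[OF A] by (auto simp: space_pair_measure)
  then show "emeasure (distr (N \<Otimes>\<^sub>M M) M snd) A = emeasure M A"
    using A by (simp add: emeasure_distr M.emeasure_pair_measure_Times N.emeasure_space_1)
qed simp

text \<open>Passing from the index set \<open>{..<N}\<close> to an arbitrary finite one allows samples to be indexed
  by the periods in which they were observed.\<close>

lemma sub_gaussian_finite_family:
  assumes D: "prob_space D" "sets D = sets borel" and sg: "sub_gaussian D \<mu>"
    and J: "finite J" "J \<noteq> {}" and x: "0 \<le> x"
  shows "measure (PiM J (\<lambda>_. D)) {Y \<in> space (PiM J (\<lambda>_. D)). x \<le> \<bar>(\<Sum>i\<in>J. Y i) / real (card J) - \<mu>\<bar>}
    \<le> 2 * exp (- (real (card J) * x\<^sup>2 / 2))"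
proof -
  let ?N = "card J"
  obtain f where f: "bij_betw f {..<?N} J"
    using ex_bij_betw_nat_finite[OF J(1)] by (auto simp: atLeast0LessThan)
  let ?K = "PiM J (\<lambda>_. D)" and ?P = "PiM {..<?N} (\<lambda>_. D)"
  let ?g = "\<lambda>Y. \<lambda>n\<in>{..<?N}. Y (f n)"
  have [measurable_cong]: "sets D = sets borel" by fact
  have distr: "distr ?K ?P ?g = ?P"
    using distr_PiM_reindex[of J "\<lambda>_. D" f "{..<?N}"] D f by (auto simp: bij_betw_def)
  have g[measurable]: "?g \<in> measurable ?K ?P"
    using f by (intro measurable_restrict measurable_component_singleton) (auto simp: bij_betw_def)
  have sum: "(\<Sum>i<?N. ?g Y i) = (\<Sum>i\<in>J. Y i)" for Y :: "_ \<Rightarrow> real"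
    using sum.reindex_bij_betw[OF f, of Y] by simp
  have meas: "{Y \<in> space ?P. Q (\<Sum>i<?N. Y i)} \<in> sets ?P" if [measurable]: "Measurable.pred borel Q" for Q
    by measurable
  have transfer: "measure ?K {Y \<in> space ?K. Q (\<Sum>i\<in>J. Y i)} = measure ?P {Y \<in> space ?P. Q (\<Sum>i<?N. Y i)}"
    if Q: "Measurable.pred borel Q" for Q
  proof -
    have "measure ?P {Y \<in> space ?P. Q (\<Sum>i<?N. Y i)}
        = measure (distr ?K ?P ?g) {Y \<in> space ?P. Q (\<Sum>i<?N. Y i)}" by (simp add: distr)
    also have "\<dots> = measure ?K (?g -` {Y \<in> space ?P. Q (\<Sum>i<?N. Y i)} \<inter> space ?K)"
      using g meas[OF Q] by (rule measure_distr)
    also have "?g -` {Y \<in> space ?P. Q (\<Sum>i<?N. Y i)} \<inter> space ?K = {Y \<in> space ?K. Q (\<Sum>i\<in>J. Y i)}"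
    proof (rule set_eqI)
      fix Y
      show "Y \<in> ?g -` {Y \<in> space ?P. Q (\<Sum>i<?N. Y i)} \<inter> space ?K
          \<longleftrightarrow> Y \<in> {Y \<in> space ?K. Q (\<Sum>i\<in>J. Y i)}"
        using measurable_space[OF g, of Y] unfolding Int_iff vimage_eq mem_Collect_eq sum by blast
    qed
    finally show ?thesis by simp
  qed
  let ?up = "{Y \<in> space ?K. (\<Sum>i\<in>J. Y i) / real ?N \<ge> \<mu> + x}"
  let ?down = "{Y \<in> space ?K. (\<Sum>i\<in>J. Y i) / real ?N \<le> \<mu> - x}"
  have N: "1 \<le> ?N" using J by (simp add: Suc_le_eq card_gt_0_iff)
  have tail: "measure ?K ?up \<le> exp (- (real ?N * x\<^sup>2 / 2))" "measure ?K ?down \<le> exp (- (real ?N * x\<^sup>2 / 2))"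
  proof -
    have "measure ?K ?up = measure ?P {Y \<in> space ?P. (\<Sum>i<?N. Y i) / real ?N \<ge> \<mu> + x}"
      by (rule transfer) measurable
    moreover have "measure ?K ?down = measure ?P {Y \<in> space ?P. (\<Sum>i<?N. Y i) / real ?N \<le> \<mu> - x}"
      by (rule transfer) measurable
    ultimately show "measure ?K ?up \<le> exp (- (real ?N * x\<^sup>2 / 2))"
        "measure ?K ?down \<le> exp (- (real ?N * x\<^sup>2 / 2))"
      using sg[unfolded sub_gaussian_def Let_def, rule_format, OF N x] by (simp_all only:)
  qed
  have sets: "?up \<in> sets ?K" "?down \<in> sets ?K" by measurable
  have union: "{Y \<in> space ?K. x \<le> \<bar>(\<Sum>i\<in>J. Y i) / real ?N - \<mu>\<bar>} = ?up \<union> ?down"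
    by (auto simp: abs_if)
  have "measure ?K (?up \<union> ?down) \<le> measure ?K ?up + measure ?K ?down"
    using sets by (rule measure_Un_le)
  then show ?thesis unfolding union using tail by linarith
qed

context
  fixes p :: "'n::finite pmf" and r :: "'n \<Rightarrow> real" and F :: "'n \<Rightarrow> real measure"
  assumes F: "reward_distributions r F"
begin

lemma
  prob_space_F: "prob_space (F j)" and sets_F[measurable_cong]: "sets (F j) = sets borel"
  and integrable_F: "integrable (F j) (\<lambda>x. x)" and mean_F: "integral\<^sup>L (F j) (\<lambda>x. x) = r j"
  and sub_gaussian_F: "sub_gaussian (F j) (r j)"
  using F by (auto simp: reward_distributions_def)

abbreviation "Samples \<equiv> PiM UNIV F"
abbreviation "Arrivals T \<equiv> PiM {1..T::nat} (\<lambda>_. measure_pmf p)"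
abbreviation "Rewards T \<equiv> PiM {1..T::nat} (\<lambda>_. PiM UNIV F)"

lemma prob_space_Samples: "prob_space Samples"
  by (intro prob_space_PiM prob_space_F)

lemma prob_space_Arrivals: "prob_space (Arrivals T)"
  by (intro prob_space_PiM prob_space_measure_pmf)

lemma prob_space_Rewards: "prob_space (Rewards T)"
  by (intro prob_space_PiM prob_space_F)

lemma prob_space_outcome: "prob_space (outcome_space p F T)"
  unfolding outcome_space_def
  by (intro prob_space_pair prob_space_Samples prob_space_Arrivals prob_space_Rewards)

lemma measurable_arrival:
  assumes "t \<in> {1..T}"
  shows "(\<lambda>\<omega>. arrival \<omega> t) \<in> measurable (outcome_space p F T) (count_space UNIV)"
proof -
  have [measurable]: "(\<lambda>a. a t) \<in> measurable (Arrivals T) (measure_pmf p)"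
    by (rule measurable_component_singleton[OF assms])
  have "(\<lambda>\<omega>. arrival \<omega> t) \<in> measurable (outcome_space p F T) (measure_pmf p)"
    unfolding arrival_def outcome_space_def by measurable
  then show ?thesis by (simp cong: measurable_cong_sets)
qed

lemma measurable_table:
  assumes "t \<in> {1..T}"
  shows "(\<lambda>\<omega>. snd (snd \<omega>) t j) \<in> borel_measurable (outcome_space p F T)"
proof -
  have [measurable]: "(\<lambda>y. y t) \<in> measurable (Rewards T) (PiM UNIV F)"
    by (rule measurable_component_singleton[OF assms])
  have [measurable]: "(\<lambda>v. v j) \<in> measurable (PiM UNIV F) (F j)"
    by (rule measurable_component_singleton) simp
  have "(\<lambda>\<omega>. snd (snd \<omega>) t j) \<in> measurable (outcome_space p F T) (F j)"
    unfolding outcome_space_def by measurable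
  then show ?thesis by (simp cong: measurable_cong_sets add: sets_F)
qed

lemma measurable_reward:
  assumes "t \<in> {1..T}"
  shows "(\<lambda>\<omega>. reward \<omega> t) \<in> borel_measurable (outcome_space p F T)"
  unfolding reward_def
  by (rule measurable_compose_countable[OF measurable_table measurable_arrival]) (use assms in auto)

lemma measurable_initial_sample:
  "(\<lambda>\<omega>. initial_sample \<omega> j) \<in> borel_measurable (outcome_space p F T)"
proof -
  have [measurable]: "(\<lambda>v. v j) \<in> measurable (PiM UNIV F) (F j)"
    by (rule measurable_component_singleton) simp
  have "(\<lambda>\<omega>. initial_sample \<omega> j) \<in> measurable (outcome_space p F T) (F j)"
    unfolding initial_sample_def outcome_space_def by measurable
  then show ?thesis by (simp cong: measurable_cong_sets add: sets_F)
qed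

lemma measurable_observed:
  assumes "A \<subseteq> {1..T}" "S \<subseteq> {1..T}"
  shows "observed A S \<in> measurable (outcome_space p F T) (data_space A S)"
proof -
  have "(\<lambda>\<omega>. (\<lambda>t\<in>A. arrival \<omega> t, \<lambda>t\<in>S. reward \<omega> t)) \<in> measurable (outcome_space p F T) (data_space A S)"
    unfolding data_space_def
    using assms by (intro measurable_Pair measurable_restrict measurable_arrival measurable_reward) auto
  then show ?thesis by (simp add: observed_def[abs_def])
qed

text \<open>Sums over a fixed set of periods make measurability evident.\<close>

lemma empirical_average_alt:
  "empirical_average T t \<omega> j =
    (initial_sample \<omega> j + (\<Sum>s\<in>{t<..T}. if arrival \<omega> s = j then reward \<omega> s else 0)) /
    (1 + (\<Sum>s\<in>{t<..T}. if arrival \<omega> s = j then 1 else 0))"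
proof -
  have "sum g {s \<in> {t<..T}. arrival \<omega> s = j} = (\<Sum>s\<in>{t<..T}. if arrival \<omega> s = j then g s else 0)"
    for g :: "nat \<Rightarrow> real" by (rule sum.inter_filter) simp
  then show ?thesis by (simp only: empirical_average_def Let_def real_of_card)
qed

lemma measurable_empirical_average:
  "(\<lambda>\<omega>. empirical_average T t \<omega> j) \<in> borel_measurable (outcome_space p F T)"
proof -
  have [measurable]: "Measurable.pred (outcome_space p F T) (\<lambda>\<omega>. arrival \<omega> s = j)"
    if "s \<in> {t<..T}" for s
    using measurable_compose[OF measurable_arrival, of s T "\<lambda>i. i = j" "count_space UNIV"] that by auto
  have [measurable]: "(\<lambda>\<omega>. reward \<omega> s) \<in> borel_measurable (outcome_space p F T)"
    if "s \<in> {t<..T}" for s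
    using that by (intro measurable_reward) auto
  note [measurable] = measurable_initial_sample
  show ?thesis unfolding empirical_average_alt
    by (intro borel_measurable_divide borel_measurable_add borel_measurable_sum measurable_initial_sample)
       measurable
qed

lemma measure_arrivals_event:
  assumes A: "{a \<in> space (Arrivals T). P a} \<in> sets (Arrivals T)"
  shows "measure (outcome_space p F T) {\<omega> \<in> space (outcome_space p F T). P (arrival \<omega>)}
    = measure (Arrivals T) {a \<in> space (Arrivals T). P a}"
proof -
  interpret S: prob_space Samples by (rule prob_space_Samples)
  interpret A: prob_space "Arrivals T" by (rule prob_space_Arrivals)
  interpret R: prob_space "Rewards T" by (rule prob_space_Rewards)
  interpret AR: prob_space "Arrivals T \<Otimes>\<^sub>M Rewards T"
    by (intro prob_space_pair prob_space_Arrivals prob_space_Rewards)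
  let ?E = "{a \<in> space (Arrivals T). P a}"
  have "{\<omega> \<in> space (outcome_space p F T). P (arrival \<omega>)}
      = space Samples \<times> (?E \<times> space (Rewards T))"
    by (auto simp: outcome_space_def space_pair_measure arrival_def[abs_def])
  moreover have "emeasure (outcome_space p F T) (space Samples \<times> (?E \<times> space (Rewards T)))
      = emeasure (Arrivals T) ?E"
    unfolding outcome_space_def using A
    by (simp add: AR.emeasure_pair_measure_Times R.emeasure_pair_measure_Times
        S.emeasure_space_1 R.emeasure_space_1 del: One_nat_def)
  ultimately show ?thesis by (simp add: measure_def)
qed

lemma AE_arrivals_in_support:
  "AE \<omega> in outcome_space p F T. \<forall>t\<in>{1..T}. arrival \<omega> t \<in> set_pmf p"
proof (rule AE_finite_allI)
  fix t assume t: "t \<in> {1..T}"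
  have snd_distr: "distr (outcome_space p F T) (Arrivals T \<Otimes>\<^sub>M Rewards T) snd = Arrivals T \<Otimes>\<^sub>M Rewards T"
    unfolding outcome_space_def
    by (intro distr_pair_snd prob_space_pair prob_space_Samples prob_space_Arrivals prob_space_Rewards)
  have "distr (Arrivals T \<Otimes>\<^sub>M Rewards T) (Arrivals T) fst = Arrivals T"
    by (rule prob_space.distr_pair_fst[OF prob_space_Rewards])
  moreover have "AE a in Arrivals T. a t \<in> set_pmf p"
    by (rule AE_PiM_component) (use t in \<open>auto simp: prob_space_measure_pmf AE_measure_pmf\<close>)
  ultimately have "AE a in distr (Arrivals T \<Otimes>\<^sub>M Rewards T) (Arrivals T) fst. a t \<in> set_pmf p"
    by (simp only:)
  then have "AE z in Arrivals T \<Otimes>\<^sub>M Rewards T. fst z t \<in> set_pmf p"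
    by (rule AE_distrD[rotated]) simp
  then have "AE z in distr (outcome_space p F T) (Arrivals T \<Otimes>\<^sub>M Rewards T) snd. fst z t \<in> set_pmf p"
    by (simp only: snd_distr)
  then have "AE \<omega> in outcome_space p F T. fst (snd \<omega>) t \<in> set_pmf p"
    by (rule AE_distrD[rotated]) (simp add: outcome_space_def)
  then show "AE \<omega> in outcome_space p F T. arrival \<omega> t \<in> set_pmf p" by (simp add: arrival_def)
qed simp

lemma integrable_table:
  assumes t: "t \<in> {1..T}"
  shows "integrable (Rewards T) (\<lambda>y. y t j)"
    and "integrable (Arrivals T \<Otimes>\<^sub>M Rewards T) (\<lambda>z. snd z t j)"
    and "integrable (outcome_space p F T) (\<lambda>\<omega>. snd (snd \<omega>) t j)"
proof -
  have t': "(\<lambda>y. y t) \<in> measurable (Rewards T) (PiM UNIV F)"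
    by (rule measurable_component_singleton[OF t])
  have j: "(\<lambda>v. v j) \<in> measurable (PiM UNIV F) (F j)"
    by (rule measurable_component_singleton) simp
  have 1: "distr (outcome_space p F T) (Arrivals T \<Otimes>\<^sub>M Rewards T) snd = Arrivals T \<Otimes>\<^sub>M Rewards T"
    unfolding outcome_space_def
    by (intro distr_pair_snd prob_space_pair prob_space_Samples prob_space_Arrivals prob_space_Rewards)
  have 2: "distr (Arrivals T \<Otimes>\<^sub>M Rewards T) (Rewards T) snd = Rewards T"
    by (intro distr_pair_snd prob_space_Arrivals prob_space_Rewards)
  have 3: "distr (Rewards T) (PiM UNIV F) (\<lambda>y. y t) = PiM UNIV F"
    using t by (intro distr_PiM_component prob_space_Samples)
  have 4: "distr (PiM UNIV F) (F j) (\<lambda>v. v j) = F j"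
    by (intro distr_PiM_component prob_space_F) simp
  have "integrable (PiM UNIV F) (\<lambda>v. v j)"
    using integrable_distr[OF j, of "\<lambda>x. x"] integrable_F[of j] 4 by simp
  then show R: "integrable (Rewards T) (\<lambda>y. y t j)"
    using integrable_distr[OF t', of "\<lambda>v. v j"] 3 by simp
  show AR: "integrable (Arrivals T \<Otimes>\<^sub>M Rewards T) (\<lambda>z. snd z t j)"
    using R integrable_distr[OF measurable_snd, of "Arrivals T" "Rewards T" "\<lambda>y. y t j"] 2 by simp
  show "integrable (outcome_space p F T) (\<lambda>\<omega>. snd (snd \<omega>) t j)"
    using AR integrable_distr[of snd "outcome_space p F T" "Arrivals T \<Otimes>\<^sub>M Rewards T" "\<lambda>z. snd z t j"] 1
    by (simp add: outcome_space_def)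
qed

text \<open>Hoeffding's inequality for the weights of the arriving items, which lie between \<open>0\<close> and the
  sum of all weights.\<close>

lemma load_deviation:
  fixes w :: "'n \<Rightarrow> real"
  assumes w: "\<And>j. 0 < w j" and t: "1 \<le> t" "t \<le> T" and \<epsilon>: "0 \<le> \<epsilon>"
  shows "measure (outcome_space p F T) {\<omega> \<in> space (outcome_space p F T).
      \<epsilon> * real t \<le> \<bar>load w A (arrival \<omega>) t - real t * mean_load p w A\<bar>}
    \<le> 2 * exp (- (2 * \<epsilon>\<^sup>2 / (\<Sum>j\<in>UNIV. w j)\<^sup>2)) ^ t"
proof -
  let ?h = "\<lambda>i. if i \<in> A then w i else 0" and ?H = "\<Sum>j\<in>UNIV. w j"
  interpret A: prob_space "Arrivals T" by (rule prob_space_Arrivals)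
  have proj: "(\<lambda>a. a s) \<in> measurable (Arrivals T) (measure_pmf p)" if "s \<in> {1..T}" for s
    by (rule measurable_component_singleton[OF that])
  have "0 < ?H" by (intro sum_pos w) auto
  have indep_all: "A.indep_vars (\<lambda>_. measure_pmf p) (\<lambda>s a. a s) {1..T}"
  proof (subst A.indep_vars_iff_distr_eq_PiM')
    have "distr (Arrivals T) (Arrivals T) (\<lambda>a. \<lambda>s\<in>{1..T}. a s) = distr (Arrivals T) (Arrivals T) (\<lambda>a. a)"
      by (rule distr_cong) (auto simp: space_PiM PiE_restrict)
    also have "\<dots> = Arrivals T" by (rule distr_id)
    also have "\<dots> = PiM {1..T} (\<lambda>s. distr (Arrivals T) (measure_pmf p) (\<lambda>a. a s))"
      by (intro PiM_cong refl distr_PiM_component[symmetric] prob_space_measure_pmf)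
    finally show "distr (Arrivals T) (Arrivals T) (\<lambda>a. \<lambda>s\<in>{1..T}. a s)
        = PiM {1..T} (\<lambda>s. distr (Arrivals T) (measure_pmf p) (\<lambda>a. a s))" .
  qed (use t proj in auto)
  have indep: "A.indep_vars (\<lambda>_. borel) (\<lambda>s a. ?h (a s)) {1..t}"
    by (rule A.indep_vars_compose2[where Y = "\<lambda>_. ?h", OF A.indep_vars_subset[OF indep_all]])
      (use t in auto)
  have h: "?h i \<in> {0..?H}" for i
    using less_imp_le[OF w] by (auto intro!: member_le_sum sum_nonneg)
  have mean: "A.expectation (\<lambda>a. ?h (a s)) = mean_load p w A" if "s \<in> {1..t}" for s
  proof -
    have s: "s \<in> {1..T}" using that t by auto
    have "A.expectation (\<lambda>a. ?h (a s)) = integral\<^sup>L (distr (Arrivals T) (measure_pmf p) (\<lambda>a. a s)) ?h"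
      using proj[OF s] by (rule integral_distr[symmetric]) simp
    also have "distr (Arrivals T) (measure_pmf p) (\<lambda>a. a s) = measure_pmf p"
      using s by (intro distr_PiM_component prob_space_measure_pmf)
    also have "integral\<^sup>L (measure_pmf p) ?h = (\<Sum>i\<in>UNIV. ?h i * pmf p i)"
      by (rule integral_measure_pmf_real) auto
    also have "\<dots> = mean_load p w A"
      unfolding mean_load_def by (rule sum.mono_neutral_cong_right) auto
    finally show ?thesis .
  qed
  interpret Hoeffding_ineq "Arrivals T" "{1..t}" "\<lambda>s a. ?h (a s)" "\<lambda>_. 0" "\<lambda>_. ?H"
      "\<Sum>s\<in>{1..t}. A.expectation (\<lambda>a. ?h (a s))"
    by unfold_locales (use indep h in auto)
  have \<mu>: "(\<Sum>s\<in>{1..t}. A.expectation (\<lambda>a. ?h (a s))) = real t * mean_load p w A"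
    using mean by simp
  have pos: "0 < (\<Sum>s\<in>{1..t}. (?H - 0)\<^sup>2)" using t \<open>0 < ?H\<close> by simp
  have "A.prob {a \<in> space (Arrivals T). \<epsilon> * real t \<le> \<bar>(\<Sum>s\<in>{1..t}. ?h (a s)) - real t * mean_load p w A\<bar>}
      \<le> 2 * exp (- 2 * (\<epsilon> * real t)\<^sup>2 / (\<Sum>s\<in>{1..t}. (?H - 0)\<^sup>2))"
    using Hoeffding_ineq_abs_ge[OF _ pos, of "\<epsilon> * real t"] \<epsilon> unfolding \<mu> by simp
  also have "- 2 * (\<epsilon> * real t)\<^sup>2 / (\<Sum>s\<in>{1..t}. (?H - 0)\<^sup>2) = real t * (- (2 * \<epsilon>\<^sup>2 / ?H\<^sup>2))"
    using t by (simp add: power_mult_distrib power2_eq_square)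
  also have "exp \<dots> = exp (- (2 * \<epsilon>\<^sup>2 / ?H\<^sup>2)) ^ t" by (rule exp_of_nat_mult)
  finally have bound: "A.prob {a \<in> space (Arrivals T).
      \<epsilon> * real t \<le> \<bar>load w A a t - real t * mean_load p w A\<bar>} \<le> 2 * exp (- (2 * \<epsilon>\<^sup>2 / ?H\<^sup>2)) ^ t"
    by (simp add: load_def)
  have [measurable]: "(\<lambda>a. ?h (a s)) \<in> borel_measurable (Arrivals T)" if "s \<in> {1..t}" for s
    using measurable_compose[OF proj, of s ?h borel] that t by auto
  have "{a \<in> space (Arrivals T). \<epsilon> * real t \<le> \<bar>load w A a t - real t * mean_load p w A\<bar>} \<in> sets (Arrivals T)"
    unfolding load_def by measurable
  from bound[folded measure_arrivals_event[OF this]] show ?thesis .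
qed

text \<open>The reward samples of type \<open>j\<close> observed when \<open>S\<close> is the set of periods in which
  it arrived. Time-to-go \<open>0\<close> is not a period, so the index \<open>0\<close> is free for the initial
  sample.\<close>

lemma measurable_samples:
  assumes S: "S \<subseteq> {1..T}"
  shows "(\<lambda>z. \<lambda>s\<in>insert 0 S. if s = 0 then fst z j else snd z s j)
    \<in> measurable (Samples \<Otimes>\<^sub>M Rewards T) (PiM (insert 0 S) (\<lambda>_. F j))"
proof (rule measurable_restrict)
  have coord: "(\<lambda>v. v j) \<in> measurable Samples (F j)"
    by (rule measurable_component_singleton) simp
  fix s assume s: "s \<in> insert 0 S"
  show "(\<lambda>z. if s = 0 then fst z j else snd z s j) \<in> measurable (Samples \<Otimes>\<^sub>M Rewards T) (F j)"
  proof (cases "s = 0")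
    case True
    then show ?thesis using measurable_compose[OF measurable_fst coord] by simp
  next
    case False
    then have "s \<in> {1..T}" using s S by auto
    then have "(\<lambda>y. y s) \<in> measurable (Rewards T) Samples"
      by (rule measurable_component_singleton)
    from measurable_compose[OF measurable_compose[OF measurable_snd this] coord]
    show ?thesis using False by simp
  qed
qed

text \<open>For a fixed set of periods these samples are independent and identically distributed.\<close>

lemma distr_samples:
  assumes S: "S \<subseteq> {1..T}"
  shows "distr (Samples \<Otimes>\<^sub>M Rewards T) (PiM (insert 0 S) (\<lambda>_. F j))
      (\<lambda>z. \<lambda>s\<in>insert 0 S. if s = 0 then fst z j else snd z s j) = PiM (insert 0 S) (\<lambda>_. F j)"
    (is "distr ?M ?P ?g = ?P")
proof -
  interpret Fj: prob_space "F j" by (rule prob_space_F)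
  interpret S: prob_space Samples by (rule prob_space_Samples)
  interpret Samples: product_prob_space F UNIV
    by (intro product_prob_spaceI prob_space_F)
  interpret R: prob_space "Rewards T" by (rule prob_space_Rewards)
  interpret Rewards: product_prob_space "\<lambda>_. Samples" "{1..T}"
    by (intro product_prob_spaceI prob_space_Samples)
  interpret P: product_sigma_finite "\<lambda>_::nat. F j" by standard
  have fin: "finite S" using S by (rule finite_subset) simp
  have "0 \<notin> S" using S by auto
  have coord: "(\<lambda>v. v j) \<in> measurable Samples (F j)"
    by (rule measurable_component_singleton) simp
  note g = measurable_samples[OF S, of j]
  show ?thesis
  proof (rule P.PiM_eqI)
    fix A assume A: "\<And>s. s \<in> insert 0 S \<Longrightarrow> A s \<in> sets (F j)"
    let ?V = "\<lambda>s. {v \<in> space Samples. v j \<in> A s}"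
    have V: "?V s \<in> sets Samples" if "s \<in> insert 0 S" for s
      using measurable_sets[OF coord A[OF that]] by (simp add: vimage_def Int_def conj_commute)
    have emeasure_V: "emeasure Samples (?V s) = emeasure (F j) (A s)" if "s \<in> insert 0 S" for s
      using that A by (intro Samples.emeasure_PiM_Collect_single) auto
    let ?E = "{y \<in> space (Rewards T). \<forall>s\<in>S. y s \<in> ?V s}"
    have E: "?E \<in> sets (Rewards T)"
    proof -
      have "{y \<in> space (Rewards T). y s \<in> ?V s} \<in> sets (Rewards T)" if "s \<in> S" for s
        using measurable_sets[OF measurable_component_singleton[of s "{1..T}" "\<lambda>_. Samples"] V[of s]] that S
        by (auto simp: vimage_def Int_def conj_commute)
      then show ?thesis using fin by (intro sets.sets_Collect_finite_All) auto
    qed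
    have "?g -` Pi\<^sub>E (insert 0 S) A \<inter> space ?M = ?V 0 \<times> ?E"
    proof (rule set_eqI)
      fix z
      have "snd z s \<in> space Samples" if "z \<in> space ?M" "s \<in> S" for s
        using that S by (auto simp: space_pair_measure space_PiM PiE_iff)
      then show "z \<in> ?g -` Pi\<^sub>E (insert 0 S) A \<inter> space ?M \<longleftrightarrow> z \<in> ?V 0 \<times> ?E"
        using \<open>0 \<notin> S\<close> by (cases z) (auto simp: space_pair_measure PiE_iff)
    qed
    then have "emeasure (distr ?M ?P ?g) (Pi\<^sub>E (insert 0 S) A) = emeasure ?M (?V 0 \<times> ?E)"
      using g A fin by (simp add: emeasure_distr sets_PiM_I_finite)
    also have "\<dots> = emeasure Samples (?V 0) * emeasure (Rewards T) ?E"
      using V E by (intro R.emeasure_pair_measure_Times) auto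
    also have "emeasure (Rewards T) ?E = (\<Prod>s\<in>S. emeasure Samples (?V s))"
      using S fin V by (intro Rewards.emeasure_PiM_Collect) auto
    also have "emeasure Samples (?V 0) * \<dots> = (\<Prod>s\<in>insert 0 S. emeasure (F j) (A s))"
      using fin \<open>0 \<notin> S\<close> emeasure_V by simp
    finally show "emeasure (distr ?M ?P ?g) (Pi\<^sub>E (insert 0 S) A) = (\<Prod>s\<in>insert 0 S. emeasure (F j) (A s))" .
  qed (use fin in simp_all)
qed

text \<open>Once the arrivals are fixed, the number of observations is no longer random and the sub-Gaussian bound
  applies.\<close>

lemma estimate_deviation_given_arrivals:
  fixes a :: "nat \<Rightarrow> 'n" and t T :: nat and j :: 'n
  assumes \<eta>: "0 \<le> \<eta>"
  defines "S \<equiv> {s \<in> {t<..T}. a s = j}"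
  shows "emeasure (Samples \<Otimes>\<^sub>M Rewards T) {z \<in> space (Samples \<Otimes>\<^sub>M Rewards T).
      \<eta> \<le> \<bar>empirical_average T t (fst z, a, snd z) j - r j\<bar>}
    \<le> ennreal (2 * exp (- (\<eta>\<^sup>2 / 2)) ^ card S)"
proof -
  let ?M = "Samples \<Otimes>\<^sub>M Rewards T" and ?P = "PiM (insert 0 S) (\<lambda>_. F j)"
  let ?g = "\<lambda>z. \<lambda>s\<in>insert 0 S. if s = 0 then fst z j else snd z s j"
  let ?D = "{Y \<in> space ?P. \<eta> \<le> \<bar>(\<Sum>s\<in>insert 0 S. Y s) / real (card (insert 0 S)) - r j\<bar>}"
  interpret P: prob_space ?P by (intro prob_space_PiM prob_space_F)
  have S: "finite S" "0 \<notin> S" "S \<subseteq> {1..T}" by (auto simp: S_def)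
  note g = measurable_samples[OF S(3), of j]
  have average: "empirical_average T t (fst z, a, snd z) j
      = (\<Sum>s\<in>insert 0 S. ?g z s) / real (card (insert 0 S))" for z
  proof -
    have "(\<Sum>s\<in>insert 0 S. ?g z s) = fst z j + (\<Sum>s\<in>S. if s = 0 then fst z j else snd z s j)"
      using S by simp
    also have "(\<Sum>s\<in>S. if s = 0 then fst z j else snd z s j) = (\<Sum>s\<in>S. reward (fst z, a, snd z) s)"
      using S(2) by (intro sum.cong) (auto simp: reward_def arrival_def S_def)
    finally have "(\<Sum>s\<in>insert 0 S. ?g z s) = fst z j + (\<Sum>s\<in>S. reward (fst z, a, snd z) s)" .
    moreover have "real (card (insert 0 S)) = 1 + real (card S)" using S by simp
    moreover have "{s \<in> {t<..T}. arrival (fst z, a, snd z) s = j} = S"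
      by (simp add: S_def arrival_def)
    ultimately show ?thesis
      by (simp only: empirical_average_def Let_def initial_sample_def fst_conv)
  qed
  have D: "?D \<in> sets ?P"
  proof -
    have [measurable]: "(\<lambda>Y. Y s) \<in> borel_measurable ?P" if "s \<in> insert 0 S" for s
      using measurable_component_singleton[OF that, of "\<lambda>_. F j"]
      by (simp cong: measurable_cong_sets add: sets_F)
    show ?thesis by measurable
  qed
  have "{z \<in> space ?M. \<eta> \<le> \<bar>empirical_average T t (fst z, a, snd z) j - r j\<bar>} = ?g -` ?D \<inter> space ?M"
    unfolding average using measurable_space[OF g] by blast
  then have "emeasure ?M {z \<in> space ?M. \<eta> \<le> \<bar>empirical_average T t (fst z, a, snd z) j - r j\<bar>}
      = emeasure (distr ?M ?P ?g) ?D"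
    using emeasure_distr[OF g D] by (simp only:)
  also have "\<dots> = ennreal (measure ?P ?D)"
    unfolding distr_samples[OF S(3)] by (rule P.emeasure_eq_measure)
  also have "measure ?P ?D \<le> 2 * exp (- (real (card (insert 0 S)) * \<eta>\<^sup>2 / 2))"
    using S \<eta> by (intro sub_gaussian_finite_family prob_space_F sets_F sub_gaussian_F) auto
  also have "\<dots> \<le> 2 * exp (real (card S) * (- (\<eta>\<^sup>2 / 2)))"
    using S by (simp add: distrib_right add_divide_distrib)
  also have "\<dots> = 2 * exp (- (\<eta>\<^sup>2 / 2)) ^ card S" by (simp only: exp_of_nat_mult)
  finally show ?thesis by (simp add: ennreal_leI)
qed

text \<open>The generating function of the binomially distributed number of arrivals of type \<open>j\<close>.\<close>

lemma expected_power_of_count: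
  assumes q: "0 \<le> q" "q \<le> 1"
  shows "(\<integral>\<^sup>+ a. ennreal (q ^ card {s \<in> {t<..T}. a s = j}) \<partial>Arrivals T)
    = ennreal ((1 - pmf p j * (1 - q)) ^ (T - t))"
proof -
  interpret product_sigma_finite "\<lambda>_::nat. measure_pmf p" by standard
  let ?f = "\<lambda>s i. if s \<in> {t<..T} \<and> i = j then ennreal q else 1"
  have power: "ennreal (q ^ card {s \<in> {t<..T}. a s = j}) = (\<Prod>s\<in>{1..T}. ?f s (a s))" for a
  proof -
    have "(\<Prod>s\<in>{1..T}. ?f s (a s)) = (\<Prod>s | s \<in> {1..T} \<and> (s \<in> {t<..T} \<and> a s = j). ennreal q)"
      by (rule prod.inter_filter[symmetric]) simp
    also have "{s. s \<in> {1..T} \<and> (s \<in> {t<..T} \<and> a s = j)} = {s \<in> {t<..T}. a s = j}" by auto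
    finally show ?thesis using q by (simp add: ennreal_power)
  qed
  have factor: "(\<integral>\<^sup>+ i. ?f s i \<partial>measure_pmf p) = ennreal (if s \<in> {t<..T} then 1 - pmf p j * (1 - q) else 1)"
    for s
  proof (cases "s \<in> {t<..T}")
    case True
    have "(\<integral>\<^sup>+ i. ?f s i \<partial>measure_pmf p) = (\<integral>\<^sup>+ i. ennreal (if i = j then q else 1) \<partial>measure_pmf p)"
      using True by (intro nn_integral_cong) auto
    also have "\<dots> = ennreal (\<integral>i. (if i = j then q else 1) \<partial>measure_pmf p)"
      using q by (intro nn_integral_eq_integral measure_pmf.integrable_const_bound[where B = 1]) auto
    also have "(\<integral>i. (if i = j then q else 1) \<partial>measure_pmf p) = (\<Sum>i\<in>UNIV. (if i = j then q else 1) * pmf p i)"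
      by (rule integral_measure_pmf_real) auto
    also have "\<dots> = (\<Sum>i\<in>UNIV. pmf p i - (if i = j then pmf p j * (1 - q) else 0))"
      by (intro sum.cong) (auto simp: algebra_simps)
    also have "\<dots> = 1 - pmf p j * (1 - q)"
      by (simp add: sum_subtractf sum_pmf_eq_1)
    finally show ?thesis using True by simp
  next
    case False
    then have "?f s = (\<lambda>_. 1)" by auto
    then show ?thesis using False by (simp only: measure_pmf.emeasure_space_1 nn_integral_const if_False) simp
  qed
  have "(\<integral>\<^sup>+ a. ennreal (q ^ card {s \<in> {t<..T}. a s = j}) \<partial>Arrivals T)
      = (\<Prod>s\<in>{1..T}. \<integral>\<^sup>+ i. ?f s i \<partial>measure_pmf p)"
    unfolding power by (rule product_nn_integral_prod) auto
  also have "\<dots> = (\<Prod>s\<in>{1..T}. if s \<in> {t<..T} then ennreal (1 - pmf p j * (1 - q)) else 1)"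
    unfolding factor by (intro prod.cong) auto
  also have "\<dots> = (\<Prod>s | s \<in> {1..T} \<and> s \<in> {t<..T}. ennreal (1 - pmf p j * (1 - q)))"
    by (rule prod.inter_filter[symmetric]) simp
  also have "{s. s \<in> {1..T} \<and> s \<in> {t<..T}} = {t<..T}" by auto
  also have "(\<Prod>s\<in>{t<..T}. ennreal (1 - pmf p j * (1 - q))) = ennreal ((1 - pmf p j * (1 - q)) ^ (T - t))"
    using mult_le_one[OF pmf_le_1, of "1 - q" p j] q by (simp add: ennreal_power)
  finally show ?thesis .
qed

text \<open>Integrating the conditional bound over the arrivals: the probability is geometric in the number of elapsed
  periods.\<close>

lemma estimate_deviation:
  assumes \<eta>: "0 \<le> \<eta>"
  shows "measure (outcome_space p F T) {\<omega> \<in> space (outcome_space p F T).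
      \<eta> \<le> \<bar>empirical_average T t \<omega> j - r j\<bar>}
    \<le> 2 * (1 - pmf p j * (1 - exp (- (\<eta>\<^sup>2 / 2)))) ^ (T - t)"
proof -
  let ?q = "exp (- (\<eta>\<^sup>2 / 2))" and ?\<Omega> = "outcome_space p F T"
  let ?E = "{\<omega> \<in> space ?\<Omega>. \<eta> \<le> \<bar>empirical_average T t \<omega> j - r j\<bar>}"
  interpret S: prob_space Samples by (rule prob_space_Samples)
  interpret A: prob_space "Arrivals T" by (rule prob_space_Arrivals)
  interpret R: prob_space "Rewards T" by (rule prob_space_Rewards)
  interpret AR: prob_space "Arrivals T \<Otimes>\<^sub>M Rewards T"
    by (intro prob_space_pair prob_space_Arrivals prob_space_Rewards)
  interpret SA: pair_sigma_finite Samples "Arrivals T" ..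
  interpret \<Omega>: prob_space ?\<Omega> by (rule prob_space_outcome)
  have E: "?E \<in> sets ?\<Omega>"
    using measurable_empirical_average by measurable
  then have ind[measurable]: "indicator ?E \<in> borel_measurable (Samples \<Otimes>\<^sub>M Arrivals T \<Otimes>\<^sub>M Rewards T)"
    by (simp only: outcome_space_def[symmetric] borel_measurable_indicator)
  have "emeasure ?\<Omega> ?E = (\<integral>\<^sup>+ \<omega>. indicator ?E \<omega> \<partial>(Samples \<Otimes>\<^sub>M Arrivals T \<Otimes>\<^sub>M Rewards T))"
    using E by (simp only: outcome_space_def[symmetric] nn_integral_indicator)
  also have "\<dots> = (\<integral>\<^sup>+ i. \<integral>\<^sup>+ z. indicator ?E (i, z) \<partial>(Arrivals T \<Otimes>\<^sub>M Rewards T) \<partial>Samples)"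
    by (rule AR.nn_integral_fst[symmetric]) (rule ind)
  also have "\<dots> = (\<integral>\<^sup>+ i. \<integral>\<^sup>+ a. \<integral>\<^sup>+ y. indicator ?E (i, a, y) \<partial>Rewards T \<partial>Arrivals T \<partial>Samples)"
  proof (rule nn_integral_cong)
    fix i assume "i \<in> space Samples"
    then have "(\<lambda>z. indicator ?E (i, z)) \<in> borel_measurable (Arrivals T \<Otimes>\<^sub>M Rewards T)"
      using measurable_compose[OF measurable_Pair1' ind] by blast
    from R.nn_integral_fst[OF this]
    show "(\<integral>\<^sup>+ z. indicator ?E (i, z) \<partial>(Arrivals T \<Otimes>\<^sub>M Rewards T))
        = (\<integral>\<^sup>+ a. \<integral>\<^sup>+ y. indicator ?E (i, a, y) \<partial>Rewards T \<partial>Arrivals T)" by (rule sym)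
  qed
  \<comment> \<open>The arrivals are moved outermost in order to condition on them.\<close>
  also have "\<dots> = (\<integral>\<^sup>+ a. \<integral>\<^sup>+ i. \<integral>\<^sup>+ y. indicator ?E (i, a, y) \<partial>Rewards T \<partial>Samples \<partial>Arrivals T)"
  proof (rule SA.Fubini'[symmetric])
    have "(\<lambda>z. indicator ?E (fst (fst z), snd (fst z), snd z))
        \<in> borel_measurable ((Samples \<Otimes>\<^sub>M Arrivals T) \<Otimes>\<^sub>M Rewards T)"
      by (rule measurable_compose[OF _ ind]) measurable
    from R.borel_measurable_nn_integral_fst[OF this]
    show "(\<lambda>(i, a). \<integral>\<^sup>+ y. indicator ?E (i, a, y) \<partial>Rewards T) \<in> borel_measurable (Samples \<Otimes>\<^sub>M Arrivals T)"
      by (simp add: case_prod_beta')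
  qed
  also have "\<dots> \<le> (\<integral>\<^sup>+ a. 2 * ennreal (?q ^ card {s \<in> {t<..T}. a s = j}) \<partial>Arrivals T)"
  proof (rule nn_integral_mono)
    fix a assume a: "a \<in> space (Arrivals T)"
    have "(\<lambda>z. (fst z, a, snd z)) \<in> measurable (Samples \<Otimes>\<^sub>M Rewards T) (Samples \<Otimes>\<^sub>M Arrivals T \<Otimes>\<^sub>M Rewards T)"
      using a by measurable
    note meas = measurable_compose[OF this ind]
    have "(\<integral>\<^sup>+ i. \<integral>\<^sup>+ y. indicator ?E (i, a, y) \<partial>Rewards T \<partial>Samples)
        = (\<integral>\<^sup>+ z. indicator ?E (fst z, a, snd z) \<partial>(Samples \<Otimes>\<^sub>M Rewards T))"
      using R.nn_integral_fst[OF meas] by simp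
    also have "\<dots> = (\<integral>\<^sup>+ z. indicator {z \<in> space (Samples \<Otimes>\<^sub>M Rewards T).
        \<eta> \<le> \<bar>empirical_average T t (fst z, a, snd z) j - r j\<bar>} z \<partial>(Samples \<Otimes>\<^sub>M Rewards T))"
      using a by (intro nn_integral_cong)
        (auto simp: indicator_def outcome_space_def space_pair_measure)
    also have "\<dots> = emeasure (Samples \<Otimes>\<^sub>M Rewards T) {z \<in> space (Samples \<Otimes>\<^sub>M Rewards T).
        \<eta> \<le> \<bar>empirical_average T t (fst z, a, snd z) j - r j\<bar>}"
    proof (rule nn_integral_indicator)
      have "{z \<in> space (Samples \<Otimes>\<^sub>M Rewards T). (indicator ?E (fst z, a, snd z) :: ennreal) = 1}
          \<in> sets (Samples \<Otimes>\<^sub>M Rewards T)"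
        using meas by measurable
      also have "{z \<in> space (Samples \<Otimes>\<^sub>M Rewards T). (indicator ?E (fst z, a, snd z) :: ennreal) = 1}
          = {z \<in> space (Samples \<Otimes>\<^sub>M Rewards T). \<eta> \<le> \<bar>empirical_average T t (fst z, a, snd z) j - r j\<bar>}"
        using a by (auto simp: indicator_def outcome_space_def space_pair_measure)
      finally show "{z \<in> space (Samples \<Otimes>\<^sub>M Rewards T).
          \<eta> \<le> \<bar>empirical_average T t (fst z, a, snd z) j - r j\<bar>} \<in> sets (Samples \<Otimes>\<^sub>M Rewards T)" .
    qed
    also have "\<dots> \<le> ennreal (2 * ?q ^ card {s \<in> {t<..T}. a s = j})"
      using \<eta> by (rule estimate_deviation_given_arrivals)
    also have "\<dots> = 2 * ennreal (?q ^ card {s \<in> {t<..T}. a s = j})"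
      by (simp add: ennreal_mult)
    finally show "(\<integral>\<^sup>+ i. \<integral>\<^sup>+ y. indicator ?E (i, a, y) \<partial>Rewards T \<partial>Samples)
        \<le> 2 * ennreal (?q ^ card {s \<in> {t<..T}. a s = j})" .
  qed
  also have "\<dots> = 2 * (\<integral>\<^sup>+ a. ennreal (?q ^ card {s \<in> {t<..T}. a s = j}) \<partial>Arrivals T)"
  proof (rule nn_integral_cmult)
    have [measurable]: "(\<lambda>a. a s) \<in> measurable (Arrivals T) (measure_pmf p)" if "s \<in> {t<..T}" for s
      using that by (intro measurable_component_singleton) auto
    have "card {s \<in> {t<..T}. a s = j} = (\<Sum>s\<in>{t<..T}. if a s = j then 1 else 0)" for a
      by (simp add: sum.If_cases Int_def)
    then show "(\<lambda>a. ennreal (?q ^ card {s \<in> {t<..T}. a s = j})) \<in> borel_measurable (Arrivals T)"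
      by simp
  qed
  also have "\<dots> = 2 * ennreal ((1 - pmf p j * (1 - ?q)) ^ (T - t))"
    by (subst expected_power_of_count) auto
  also have "\<dots> = ennreal (2 * (1 - pmf p j * (1 - ?q)) ^ (T - t))"
    using mult_le_one[OF pmf_le_1, of "1 - ?q" p j] by (simp add: ennreal_mult)
  finally show ?thesis
    using mult_le_one[OF pmf_le_1, of "1 - ?q" p j] by (simp add: \<Omega>.emeasure_eq_measure)
qed

text \<open>Invariance under updates at \<open>t\<close> says that \<open>h\<close> does not depend on the rewards of
  period \<open>t\<close>, so these can be integrated first.\<close>

lemma integral_unseen_reward:
  assumes t: "t \<in> {1..T}"
    and meas: "h \<in> borel_measurable (Rewards T)" and bound: "\<And>y. \<bar>h y\<bar> \<le> (1::real)"
    and unseen: "\<And>y v. h (y(t := v)) = h y"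
  shows "(\<integral>y. h y * y t j \<partial>Rewards T) = r j * (\<integral>y. h y \<partial>Rewards T)"
proof -
  interpret Samples: prob_space Samples by (rule prob_space_Samples)
  interpret product_sigma_finite "\<lambda>_::nat. Samples" by standard
  interpret R: prob_space "Rewards T" by (rule prob_space_Rewards)
  let ?I = "{1..T} - {t}"
  have split: "{1..T} = insert t ?I" using t by auto
  have distr: "distr Samples (F j) (\<lambda>v. v j) = F j"
    by (intro distr_PiM_component prob_space_F) simp
  have proj: "(\<lambda>v. v j) \<in> measurable Samples (F j)"
    by (rule measurable_component_singleton) simp
  have mean_v: "(\<integral>v. v j \<partial>Samples) = r j"
    using integral_distr[OF proj borel_measurable_integrable[OF integrable_F]] mean_F[of j]
    unfolding distr by simp
  note int_y = integrable_table(1)[OF t, of j]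
  have int_h: "integrable (Rewards T) h"
    using bound by (intro R.integrable_const_bound[where B = 1] meas) auto
  have int_hy: "integrable (Rewards T) (\<lambda>y. h y * y t j)"
  proof (rule Bochner_Integration.integrable_bound[OF int_y])
    show "(\<lambda>y. h y * y t j) \<in> borel_measurable (Rewards T)"
      using meas borel_measurable_integrable[OF int_y] by (rule borel_measurable_times)
    show "AE y in Rewards T. norm (h y * y t j) \<le> norm (y t j)"
      using bound by (auto simp: abs_mult intro!: mult_left_le_one_le)
  qed
  have "(\<integral>y. h y * y t j \<partial>Rewards T)
      = (\<integral>x. \<integral>v. h (x(t := v)) * (x(t := v)) t j \<partial>Samples \<partial>PiM ?I (\<lambda>_. Samples))"
    using product_integral_insert[of ?I t "\<lambda>y. h y * y t j"] int_hy by (simp only: split[symmetric]) simp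
  also have "\<dots> = (\<integral>x. r j * h x \<partial>PiM ?I (\<lambda>_. Samples))"
    by (simp add: unseen mean_v mult.commute)
  also have "\<dots> = r j * (\<integral>x. h x \<partial>PiM ?I (\<lambda>_. Samples))"
    by simp
  also have "(\<integral>x. h x \<partial>PiM ?I (\<lambda>_. Samples)) = (\<integral>x. \<integral>v. h (x(t := v)) \<partial>Samples \<partial>PiM ?I (\<lambda>_. Samples))"
    by (simp add: unseen Samples.prob_space)
  also have "\<dots> = (\<integral>y. h y \<partial>Rewards T)"
    using product_integral_insert[of ?I t h] int_h by (simp only: split[symmetric]) simp
  finally show ?thesis .
qed

lemma integral_unseen_reward_outcome:
  assumes t: "t \<in> {1..T}"
    and meas: "Measurable.pred (outcome_space p F T) H"
    and unseen: "\<And>i a y v. H (i, a, y(t := v)) = H (i, a, y)"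
  shows "integrable (outcome_space p F T) (\<lambda>\<omega>. of_bool (H \<omega>) * snd (snd \<omega>) t j)" (is ?int)
    and "(\<integral>\<omega>. of_bool (H \<omega>) * snd (snd \<omega>) t j \<partial>outcome_space p F T)
      = (\<integral>\<omega>. of_bool (H \<omega>) * r j \<partial>outcome_space p F T)" (is ?eq)
proof -
  interpret S: prob_space Samples by (rule prob_space_Samples)
  interpret A: prob_space "Arrivals T" by (rule prob_space_Arrivals)
  interpret R: prob_space "Rewards T" by (rule prob_space_Rewards)
  interpret AR: prob_space "Arrivals T \<Otimes>\<^sub>M Rewards T"
    by (intro prob_space_pair prob_space_Arrivals prob_space_Rewards)
  interpret pAR: pair_sigma_finite "Arrivals T" "Rewards T" ..
  interpret pSAR: pair_sigma_finite Samples "Arrivals T \<Otimes>\<^sub>M Rewards T" ..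
  interpret \<Omega>: prob_space "outcome_space p F T" by (rule prob_space_outcome)
  let ?h = "\<lambda>\<omega>. of_bool (H \<omega>) :: real"
  have h: "?h \<in> borel_measurable (outcome_space p F T)"
    using meas by measurable
  show int: ?int
  proof (rule Bochner_Integration.integrable_bound[OF integrable_table(3)[OF t]])
    show "(\<lambda>\<omega>. ?h \<omega> * snd (snd \<omega>) t j) \<in> borel_measurable (outcome_space p F T)"
      using h measurable_table[OF t] by (rule borel_measurable_times)
  qed auto
  have int_mean: "integrable (outcome_space p F T) (\<lambda>\<omega>. ?h \<omega> * r j)"
    using h by (intro integrable_mult_left \<Omega>.integrable_const_bound[where B = 1]) auto
  have iterated: "(\<integral>\<omega>. f \<omega> \<partial>outcome_space p F T)
      = (\<integral>i. \<integral>a. \<integral>y. f (i, a, y) \<partial>Rewards T \<partial>Arrivals T \<partial>Samples)"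
    if f: "integrable (outcome_space p F T) f"
      and sections: "\<And>i. i \<in> space Samples \<Longrightarrow> integrable (Arrivals T \<Otimes>\<^sub>M Rewards T) (\<lambda>z. f (i, z))"
    for f :: "_ \<Rightarrow> real"
  proof -
    have "(\<integral>\<omega>. f \<omega> \<partial>outcome_space p F T) = (\<integral>i. \<integral>z. f (i, z) \<partial>(Arrivals T \<Otimes>\<^sub>M Rewards T) \<partial>Samples)"
      using f unfolding outcome_space_def by (rule pSAR.integral_fst'[symmetric])
    also have "\<dots> = (\<integral>i. \<integral>a. \<integral>y. f (i, a, y) \<partial>Rewards T \<partial>Arrivals T \<partial>Samples)"
      using pAR.integral_fst'[OF sections] by (intro Bochner_Integration.integral_cong) auto
    finally show ?thesis .
  qed
  have slice: "(\<lambda>z. ?h (i, z)) \<in> borel_measurable (Arrivals T \<Otimes>\<^sub>M Rewards T)" if "i \<in> space Samples" for i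
    using measurable_compose[OF measurable_Pair1'[OF that] h[unfolded outcome_space_def]] .
  note int_snd = integrable_table(2)[OF t, of j]
  have sections: "integrable (Arrivals T \<Otimes>\<^sub>M Rewards T) (\<lambda>z. ?h (i, z) * snd z t j)"
      "integrable (Arrivals T \<Otimes>\<^sub>M Rewards T) (\<lambda>z. ?h (i, z) * r j)" if "i \<in> space Samples" for i
  proof -
    show "integrable (Arrivals T \<Otimes>\<^sub>M Rewards T) (\<lambda>z. ?h (i, z) * snd z t j)"
    proof (rule Bochner_Integration.integrable_bound[OF int_snd])
      show "(\<lambda>z. ?h (i, z) * snd z t j) \<in> borel_measurable (Arrivals T \<Otimes>\<^sub>M Rewards T)"
        using slice[OF that] borel_measurable_integrable[OF int_snd] by (rule borel_measurable_times)
    qed auto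
    show "integrable (Arrivals T \<Otimes>\<^sub>M Rewards T) (\<lambda>z. ?h (i, z) * r j)"
      using slice[OF that] by (intro integrable_mult_left AR.integrable_const_bound[where B = 1]) auto
  qed
  have "(\<integral>\<omega>. ?h \<omega> * snd (snd \<omega>) t j \<partial>outcome_space p F T)
      = (\<integral>i. \<integral>a. \<integral>y. ?h (i, a, y) * y t j \<partial>Rewards T \<partial>Arrivals T \<partial>Samples)"
    by (subst iterated[OF int]) (use sections in simp_all)
  also have "\<dots> = (\<integral>i. \<integral>a. \<integral>y. ?h (i, a, y) * r j \<partial>Rewards T \<partial>Arrivals T \<partial>Samples)"
  proof (rule Bochner_Integration.integral_cong[OF refl], rule Bochner_Integration.integral_cong[OF refl])
    fix i a assume i: "i \<in> space Samples" and a: "a \<in> space (Arrivals T)"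
    have "(\<lambda>y. ?h (i, a, y)) \<in> borel_measurable (Rewards T)"
      using measurable_compose[OF measurable_Pair1'[OF a] slice[OF i]] .
    then show "(\<integral>y. ?h (i, a, y) * y t j \<partial>Rewards T) = (\<integral>y. ?h (i, a, y) * r j \<partial>Rewards T)"
      using t by (subst integral_unseen_reward) (auto simp: unseen)
  qed
  also have "\<dots> = (\<integral>\<omega>. ?h \<omega> * r j \<partial>outcome_space p F T)"
    by (subst iterated[OF int_mean]) (use sections in simp_all)
  finally show ?eq .
qed

text \<open>Non-anticipating decisions cannot exploit the realized reward of the arriving item, so its mean may be
  collected instead.\<close>

lemma expected_reward_eq_mean:
  assumes meas: "\<And>t. t \<in> {1..T} \<Longrightarrow> d t \<in> measurable (outcome_space p F T) (count_space UNIV)"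
    and unseen: "\<And>t i a y v. t \<in> {1..T} \<Longrightarrow> d t (i, a, y(t := v)) = d t (i, a, y)"
  shows "integrable (outcome_space p F T) (\<lambda>\<omega>. \<Sum>t=1..T. if d t \<omega> = Accept then r (arrival \<omega> t) else 0)"
    and "expected_reward p F T d
      = (\<integral>\<omega>. (\<Sum>t=1..T. if d t \<omega> = Accept then r (arrival \<omega> t) else 0) \<partial>outcome_space p F T)"
proof -
  interpret \<Omega>: prob_space "outcome_space p F T" by (rule prob_space_outcome)
  \<comment> \<open>The arriving type is random, so it is split into cases before the previous lemma applies
    to each column of the reward table.\<close>
  let ?H = "\<lambda>t j \<omega>. d t \<omega> = Accept \<and> arrival \<omega> t = j"
  have split: "(if d t \<omega> = Accept then f (arrival \<omega> t) else 0) = (\<Sum>j\<in>UNIV. of_bool (?H t j \<omega>) * f j)"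
    for t \<omega> and f :: "_ \<Rightarrow> real"
  proof -
    have "(\<Sum>j\<in>UNIV. of_bool (?H t j \<omega>) * f j)
        = (\<Sum>j\<in>UNIV. if arrival \<omega> t = j then of_bool (d t \<omega> = Accept) * f j else 0)"
      by (intro sum.cong) auto
    then show ?thesis by simp
  qed
  have H: "Measurable.pred (outcome_space p F T) (?H t j)" if "t \<in> {1..T}" for t j
  proof -
    note [measurable] = meas[OF that] measurable_arrival[OF that]
    show ?thesis by measurable
  qed
  have H_unseen: "?H t j (i, a, y(t := v)) = ?H t j (i, a, y)" if "t \<in> {1..T}" for t j i a y v
    using unseen[OF that] by (simp add: arrival_def)
  note unseen_reward = integral_unseen_reward_outcome[OF _ H H_unseen]
  have int_mean: "integrable (outcome_space p F T) (\<lambda>\<omega>. of_bool (?H t j \<omega>) * r j)" if "t \<in> {1..T}" for t j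
    using H[OF that] by (intro integrable_mult_left \<Omega>.integrable_const_bound[where B = 1]) auto
  show "integrable (outcome_space p F T) (\<lambda>\<omega>. \<Sum>t=1..T. if d t \<omega> = Accept then r (arrival \<omega> t) else 0)"
    unfolding split[of _ _ r] by (intro Bochner_Integration.integrable_sum int_mean) auto
  have swap: "(\<integral>\<omega>. (\<Sum>t=1..T. \<Sum>j\<in>UNIV. G t j \<omega>) \<partial>outcome_space p F T)
      = (\<Sum>t=1..T. \<Sum>j\<in>UNIV. \<integral>\<omega>. G t j \<omega> \<partial>outcome_space p F T)"
    if G: "\<And>t j. t \<in> {1..T} \<Longrightarrow> integrable (outcome_space p F T) (G t j)"
    for G :: "nat \<Rightarrow> 'n \<Rightarrow> 'n outcome \<Rightarrow> real"
  proof -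
    have "(\<integral>\<omega>. (\<Sum>t=1..T. \<Sum>j\<in>UNIV. G t j \<omega>) \<partial>outcome_space p F T)
        = (\<Sum>t=1..T. \<integral>\<omega>. (\<Sum>j\<in>UNIV. G t j \<omega>) \<partial>outcome_space p F T)"
      by (rule Bochner_Integration.integral_sum) (intro Bochner_Integration.integrable_sum G)
    also have "\<dots> = (\<Sum>t=1..T. \<Sum>j\<in>UNIV. \<integral>\<omega>. G t j \<omega> \<partial>outcome_space p F T)"
      using G by (intro sum.cong refl Bochner_Integration.integral_sum)
    finally show ?thesis .
  qed
  have "expected_reward p F T d
      = (\<integral>\<omega>. (\<Sum>t=1..T. \<Sum>j\<in>UNIV. of_bool (?H t j \<omega>) * snd (snd \<omega>) t j) \<partial>outcome_space p F T)"
    unfolding expected_reward_def reward_def split ..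
  also have "\<dots> = (\<Sum>t=1..T. \<Sum>j\<in>UNIV. \<integral>\<omega>. of_bool (?H t j \<omega>) * snd (snd \<omega>) t j \<partial>outcome_space p F T)"
    using unseen_reward(1) by (rule swap)
  also have "\<dots> = (\<Sum>t=1..T. \<Sum>j\<in>UNIV. \<integral>\<omega>. of_bool (?H t j \<omega>) * r j \<partial>outcome_space p F T)"
    using unseen_reward(2) by (intro sum.cong refl) blast
  also have "\<dots> = (\<integral>\<omega>. (\<Sum>t=1..T. \<Sum>j\<in>UNIV. of_bool (?H t j \<omega>) * r j) \<partial>outcome_space p F T)"
    using int_mean by (rule swap[symmetric])
  finally show "expected_reward p F T d
      = (\<integral>\<omega>. (\<Sum>t=1..T. if d t \<omega> = Accept then r (arrival \<omega> t) else 0) \<partial>outcome_space p F T)"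
    unfolding split[of _ _ r] .
qed

end

section \<open>Capacity and information along an outcome\<close>

lemma observed_unseen: "t \<notin> S \<Longrightarrow> observed A S (i, a, y(t := v)) = observed A S (i, a, y)"
  by (auto simp: observed_def arrival_def reward_def restrict_def fun_eq_iff)

lemma capacity_Suc:
  assumes "t < T"
  shows "capacity w T B d t \<omega>
    = capacity w T B d (Suc t) \<omega> - (if d (Suc t) \<omega> = Accept then w (arrival \<omega> (Suc t)) else 0)"
proof -
  let ?S = "\<lambda>u. {s \<in> {u<..T}. d s \<omega> = Accept}"
  have "?S t = (if d (Suc t) \<omega> = Accept then insert (Suc t) (?S (Suc t)) else ?S (Suc t))"
    using assms by (auto simp: Suc_le_eq elim: le_neq_implies_less dest: Suc_lessI)
  moreover have "finite (?S (Suc t))" "Suc t \<notin> ?S (Suc t)" by auto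
  ultimately show ?thesis by (simp add: capacity_def)
qed

lemma capacity_start: "capacity w T B d T \<omega> = B"
  by (simp add: capacity_def)

text \<open>Every acceptance leaves a nonnegative capacity, in particular the last one does.\<close>

lemma feasible_within_budget:
  assumes "0 \<le> B" and feasible: "\<And>t. t \<in> {1..T} \<Longrightarrow> d t \<omega> \<in> feasible_actions w T B d t \<omega>"
  shows "(\<Sum>t | t \<in> {1..T} \<and> d t \<omega> = Accept. w (arrival \<omega> t)) \<le> B"
proof -
  have "0 \<le> capacity w T B d (T - k) \<omega>" if "k \<le> T" for k
    using that
  proof (induction k)
    case 0
    then show ?case using \<open>0 \<le> B\<close> by (simp add: capacity_start)
  next
    case (Suc k)
    then have T: "T - Suc k < T" "Suc (T - Suc k) = T - k" "T - k \<in> {1..T}" by auto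
    show ?case
      using Suc feasible[OF T(3)] capacity_Suc[OF T(1), of w B d \<omega>]
      by (auto simp: T(2) feasible_actions_def)
  qed
  from this[of T] show ?thesis by (simp add: capacity_def atLeastSucAtMost_greaterThanAtMost)
qed

section \<open>Expected losses\<close>

lemma (in prob_space)
  assumes "{x \<in> space M. P x} \<in> sets M"
  shows integrable_of_bool: "integrable M (\<lambda>x. of_bool (P x) :: real)"
    and integral_of_bool: "(\<integral>x. of_bool (P x) \<partial>M) = prob {x \<in> space M. P x}"
proof -
  have ind: "of_bool (P x) = (indicator {x \<in> space M. P x} x :: real)" if "x \<in> space M" for x
    using that by (simp add: indicator_def)
  show "integrable M (\<lambda>x. of_bool (P x) :: real)"
    using assms by (subst Bochner_Integration.integrable_cong[OF refl ind]) (auto simp: emeasure_eq_measure)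
  show "(\<integral>x. of_bool (P x) \<partial>M) = prob {x \<in> space M. P x}"
    using assms by (subst Bochner_Integration.integral_cong[OF refl ind]) auto
qed

lemma sum_power_le:
  fixes c :: real
  assumes "0 \<le> c" "c < 1"
  shows "(\<Sum>t=1..T. c ^ t) \<le> 1 / (1 - c)" and "(\<Sum>t=1..T. c ^ (T - t)) \<le> 1 / (1 - c)"
proof -
  have s: "summable (\<lambda>t. c ^ t)" using assms by (intro summable_geometric) auto
  have le: "(\<Sum>t\<in>S. c ^ t) \<le> 1 / (1 - c)" if "finite S" for S
    using sum_le_suminf[OF s that] suminf_geometric[of c] assms by simp
  show "(\<Sum>t=1..T. c ^ t) \<le> 1 / (1 - c)" by (rule le) simp
  have "(\<Sum>t=1..T. c ^ (T - t)) = (\<Sum>t<T. c ^ (T - Suc t))" by (simp add: sum.atLeast1_atMost_eq)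
  also have "\<dots> = (\<Sum>t<T. c ^ t)" by (rule sum.nat_diff_reindex)
  also have "\<dots> \<le> 1 / (1 - c)" by (rule le) simp
  finally show "(\<Sum>t=1..T. c ^ (T - t)) \<le> 1 / (1 - c)" .
qed

definition load_deviates :: "'n::finite pmf \<Rightarrow> ('n \<Rightarrow> real) \<Rightarrow> real \<Rightarrow> 'n set \<Rightarrow> nat \<Rightarrow> 'n outcome \<Rightarrow> bool" where
  "load_deviates p w \<epsilon> A t \<omega> \<longleftrightarrow> \<epsilon> * real t \<le> \<bar>load w A (arrival \<omega>) t - real t * mean_load p w A\<bar>"

definition misjudged :: "('n \<Rightarrow> real) \<Rightarrow> real \<Rightarrow> nat \<Rightarrow> 'n \<Rightarrow> nat \<Rightarrow> 'n outcome \<Rightarrow> bool" where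
  "misjudged r \<eta> T j t \<omega> \<longleftrightarrow> \<eta> \<le> \<bar>empirical_average T t \<omega> j - r j\<bar>"

text \<open>An upper bound, with measurable and separately estimable terms, on the indicator of the periods in which
  the decision of the policy might lose value.\<close>

definition defects ::
  "'n::finite pmf \<Rightarrow> ('n \<Rightarrow> real) \<Rightarrow> ('n \<Rightarrow> real) \<Rightarrow> real \<Rightarrow> real \<Rightarrow> nat \<Rightarrow> nat \<Rightarrow> nat \<Rightarrow> 'n outcome \<Rightarrow> real" where
  "defects p r w \<epsilon> \<eta> t0 T t \<omega> = of_bool (t < t0)
     + (\<Sum>j\<in>UNIV. of_bool (load_deviates p w \<epsilon> (better r w j) t \<omega>))
     + (\<Sum>j\<in>UNIV. of_bool (load_deviates p w \<epsilon> (at_least_as_good r w j) t \<omega>))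
     + (\<Sum>j\<in>set_pmf p. of_bool (misjudged r \<eta> T j t \<omega>))"

text \<open>The bound on the expected total number of defects: constants for the last periods, geometric series in the
  time-to-go for the two kinds of load, and geometric series in the elapsed time for the estimates.\<close>

definition loss_bound :: "'n::finite pmf \<Rightarrow> ('n \<Rightarrow> real) \<Rightarrow> real \<Rightarrow> real \<Rightarrow> nat \<Rightarrow> real" where
  "loss_bound p w \<epsilon> \<eta> t0 =
     (let c = exp (- (2 * \<epsilon>\<^sup>2 / (\<Sum>j\<in>UNIV. w j)\<^sup>2)); q = exp (- (\<eta>\<^sup>2 / 2))
      in real t0 + 2 * (real CARD('n) * (2 / (1 - c))) + (\<Sum>j\<in>set_pmf p. 2 / (pmf p j * (1 - q))))"

lemma one_le_defects:
  assumes "t < t0 \<or> (\<exists>j. load_deviates p w \<epsilon> (better r w j) t \<omega>)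
    \<or> (\<exists>j. load_deviates p w \<epsilon> (at_least_as_good r w j) t \<omega>) \<or> (\<exists>j\<in>set_pmf p. misjudged r \<eta> T j t \<omega>)"
  shows "1 \<le> defects p r w \<epsilon> \<eta> t0 T t \<omega>"
proof -
  let ?D1 = "\<Sum>j\<in>UNIV. of_bool (load_deviates p w \<epsilon> (better r w j) t \<omega>) :: real"
  let ?D2 = "\<Sum>j\<in>UNIV. of_bool (load_deviates p w \<epsilon> (at_least_as_good r w j) t \<omega>) :: real"
  let ?D3 = "\<Sum>j\<in>set_pmf p. of_bool (misjudged r \<eta> T j t \<omega>) :: real"
  have pos: "0 \<le> ?D1" "0 \<le> ?D2" "0 \<le> ?D3" by (auto intro!: sum_nonneg)
  have one: "1 \<le> (\<Sum>j\<in>S. of_bool (P j) :: real)" if "j \<in> S" "P j" for S :: "'a set" and P j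
    using member_le_sum[of j S "\<lambda>j. of_bool (P j) :: real"] that by simp
  from assms show ?thesis
  proof (elim disjE exE bexE)
    assume "t < t0"
    then show ?thesis using pos by (simp add: defects_def)
  next
    fix j assume "load_deviates p w \<epsilon> (better r w j) t \<omega>"
    then have "1 \<le> ?D1" by (intro one[of j]) auto
    then show ?thesis using pos by (simp add: defects_def)
  next
    fix j assume "load_deviates p w \<epsilon> (at_least_as_good r w j) t \<omega>"
    then have "1 \<le> ?D2" by (intro one[of j]) auto
    then show ?thesis using pos by (simp add: defects_def)
  next
    fix j assume "j \<in> set_pmf p" "misjudged r \<eta> T j t \<omega>"
    then have "1 \<le> ?D3" by (intro one[of j]) auto
    then show ?thesis using pos by (simp add: defects_def)
  qed
qed

text \<open>The potential argument applied to the policy: in a period without defects the solution of the linear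
  program that it follows justifies its decision.\<close>

lemma rabbi_pathwise:
  fixes p :: "'n::finite pmf" and r w :: "'n \<Rightarrow> real"
  assumes w: "\<And>j. 0 < w j" and \<eta>: "resolves r w \<eta>"
    and \<epsilon>: "\<And>j. j \<in> set_pmf p \<Longrightarrow> \<epsilon> \<le> w j * pmf p j / 4"
    and t0: "\<And>j. j \<in> set_pmf p \<Longrightarrow> 4 \<le> real t0 * pmf p j"
    and rabbi: "learning_rabbi p w T B \<pi>"
    and support: "\<And>t. t \<in> {1..T} \<Longrightarrow> arrival \<omega> t \<in> set_pmf p"
  shows "relaxation r w B (arrival \<omega>) T
    \<le> (\<Sum>t=1..T. if online_decision T \<pi> t \<omega> = Accept then r (arrival \<omega> t) else 0)
      + max_loss r w * (\<Sum>t=1..T. defects p r w \<epsilon> \<eta> t0 T t \<omega>)"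
proof -
  let ?d = "online_decision T \<pi>" and ?a = "arrival \<omega>"
  let ?c = "\<lambda>t. capacity w T B ?d t \<omega>"
  obtain x where opt: "\<And>t. t \<in> {1..T} \<Longrightarrow>
      lp_optimal w (?c t) (empirical_average T t \<omega>) (\<lambda>j. real t * pmf p j) (x t)"
    and arg_max: "\<And>t. t \<in> {1..T} \<Longrightarrow>
      is_arg_max (x t (?a t)) (\<lambda>u. u \<in> feasible_actions w T B ?d t \<omega>) (?d t \<omega>)"
  proof -
    obtain X where "\<forall>t\<in>{1..T}. \<forall>\<omega>.
          lp_optimal w (capacity w T B ?d t \<omega>) (empirical_average T t \<omega>)
               (\<lambda>j. real t * pmf p j) (X t (initial_sample \<omega>, observed {t<..T} {t<..T} \<omega>)) \<and>
             is_arg_max (X t (initial_sample \<omega>, observed {t<..T} {t<..T} \<omega>) (arrival \<omega> t))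
               (\<lambda>u. u \<in> feasible_actions w T B ?d t \<omega>) (?d t \<omega>)"
      using rabbi unfolding learning_rabbi_def Let_def by blast
    then show ?thesis using that[of "\<lambda>t. X t (initial_sample \<omega>, observed {t<..T} {t<..T} \<omega>)"] by blast
  qed
  define Bad where "Bad = {t. t < t0 \<or> (\<exists>j. load_deviates p w \<epsilon> (better r w j) t \<omega>)
    \<or> (\<exists>j. load_deviates p w \<epsilon> (at_least_as_good r w j) t \<omega>) \<or> (\<exists>j\<in>set_pmf p. misjudged r \<eta> T j t \<omega>)}"
  have good: "4 \<le> real (Suc t) * pmf p (?a (Suc t))"
      "\<And>i. i \<in> set_pmf p \<Longrightarrow> \<bar>empirical_average T (Suc t) \<omega> i - r i\<bar> < \<eta>"
      "\<And>j. load w (better r w j) ?a (Suc t)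
        \<le> real (Suc t) * mean_load p w (better r w j) + \<epsilon> * real (Suc t)"
      "\<And>j. real (Suc t) * mean_load p w (at_least_as_good r w j) - \<epsilon> * real (Suc t)
        \<le> load w (at_least_as_good r w j) ?a (Suc t)"
    if "t < T" "Suc t \<notin> Bad" for t
  proof -
    have "t0 \<le> Suc t" using that by (auto simp: Bad_def)
    then have "real t0 * pmf p (?a (Suc t)) \<le> real (Suc t) * pmf p (?a (Suc t))"
      by (intro mult_right_mono) auto
    then show "4 \<le> real (Suc t) * pmf p (?a (Suc t))" using t0[OF support[of "Suc t"]] that by simp
    show "\<bar>empirical_average T (Suc t) \<omega> i - r i\<bar> < \<eta>" if "i \<in> set_pmf p" for i
      using \<open>Suc t \<notin> Bad\<close> that unfolding Bad_def misjudged_def by (auto simp: not_le)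
    fix j
    have "\<not> load_deviates p w \<epsilon> (better r w j) (Suc t) \<omega>" "\<not> load_deviates p w \<epsilon> (at_least_as_good r w j) (Suc t) \<omega>"
      using \<open>Suc t \<notin> Bad\<close> by (auto simp: Bad_def)
    then show "load w (better r w j) ?a (Suc t)
        \<le> real (Suc t) * mean_load p w (better r w j) + \<epsilon> * real (Suc t)"
      "real (Suc t) * mean_load p w (at_least_as_good r w j) - \<epsilon> * real (Suc t)
        \<le> load w (at_least_as_good r w j) ?a (Suc t)"
      unfolding load_deviates_def by linarith+
  qed
  have "relaxation r w (?c T) ?a T
    \<le> (\<Sum>t=1..T. if t \<in> {t. ?d t \<omega> = Accept} then r (?a t) else 0)
      + max_loss r w * (\<Sum>t=1..T. of_bool (t \<in> Bad))"
  proof (rule relaxation_le_collected[where c = ?c and w = w, OF w])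
    fix t assume t: "t < T"
    then have Suc_t: "Suc t \<in> {1..T}" by simp
    show step: "?c t = ?c (Suc t) - (if Suc t \<in> {t. ?d t \<omega> = Accept} then w (?a (Suc t)) else 0)"
      using capacity_Suc[OF t, of w B ?d \<omega>] by (simp only: mem_Collect_eq)
    assume "Suc t \<notin> Bad"
    note good = good[OF t this]
    {
      assume "Suc t \<in> {t. ?d t \<omega> = Accept}"
      then have "x (Suc t) (?a (Suc t)) Reject \<le> x (Suc t) (?a (Suc t)) Accept"
        using arg_max[OF Suc_t] by (auto simp: is_arg_max_linorder feasible_actions_def)
      from rabbi_accept_leaves_room[OF w \<eta> support[OF Suc_t] \<epsilon>[OF support[OF Suc_t]] good(1,2) opt[OF Suc_t] this good(3)]
      show "0 \<le> r (?a (Suc t)) \<and> load w (better r w (?a (Suc t))) ?a t \<le> ?c t"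
        using step \<open>Suc t \<in> {t. ?d t \<omega> = Accept}\<close> by simp
    next
      assume rej: "Suc t \<notin> {t. ?d t \<omega> = Accept}"
      have "x (Suc t) (?a (Suc t)) Accept \<le> x (Suc t) (?a (Suc t)) Reject"
        if "w (?a (Suc t)) \<le> ?c (Suc t)"
        using arg_max[OF Suc_t] rej that
        by (cases "?d (Suc t) \<omega>") (auto simp: is_arg_max_linorder feasible_actions_def)
      from rabbi_reject_is_tight[OF w \<eta> support[OF Suc_t] \<epsilon>[OF support[OF Suc_t]] good(1,2) opt[OF Suc_t] this good(4)]
      show "r (?a (Suc t)) \<le> 0 \<or> ?c t \<le> load w (at_least_as_good r w (?a (Suc t))) ?a t"
        using step rej by simp
    }
  qed
  moreover have "(\<Sum>t=1..T. of_bool (t \<in> Bad)) \<le> (\<Sum>t=1..T. defects p r w \<epsilon> \<eta> t0 T t \<omega>)"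
  proof (rule sum_mono)
    fix t
    have "0 \<le> defects p r w \<epsilon> \<eta> t0 T t \<omega>"
      unfolding defects_def by (intro add_nonneg_nonneg sum_nonneg) auto
    then show "of_bool (t \<in> Bad) \<le> defects p r w \<epsilon> \<eta> t0 T t \<omega>"
      using one_le_defects[of t t0 p w \<epsilon> r \<omega> \<eta> T] by (auto simp: Bad_def)
  qed
  then have "max_loss r w * (\<Sum>t=1..T. of_bool (t \<in> Bad))
      \<le> max_loss r w * (\<Sum>t=1..T. defects p r w \<epsilon> \<eta> t0 T t \<omega>)"
    using max_loss_bounds(2)[where w = w and r = r and j = undefined, OF w] by (intro mult_left_mono) auto
  ultimately show ?thesis unfolding capacity_start mem_Collect_eq by linarith
qed

lemma expected_defects:
  fixes p :: "'n::finite pmf" and r w :: "'n \<Rightarrow> real"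
  assumes F: "reward_distributions r F" and w: "\<And>j. 0 < w j" and \<epsilon>: "0 < \<epsilon>" and \<eta>: "0 < \<eta>"
  shows "integrable (outcome_space p F T) (\<lambda>\<omega>. \<Sum>t=1..T. defects p r w \<epsilon> \<eta> t0 T t \<omega>)"
    and "(\<integral>\<omega>. (\<Sum>t=1..T. defects p r w \<epsilon> \<eta> t0 T t \<omega>) \<partial>outcome_space p F T) \<le> loss_bound p w \<epsilon> \<eta> t0"
proof -
  let ?\<Omega> = "outcome_space p F T"
  interpret \<Omega>: prob_space ?\<Omega> using F by (rule prob_space_outcome)
  define c where "c = exp (- (2 * \<epsilon>\<^sup>2 / (\<Sum>j\<in>UNIV. w j)\<^sup>2))"
  define q where "q = exp (- (\<eta>\<^sup>2 / 2))"
  have "0 < (\<Sum>j\<in>UNIV. w j)" by (intro sum_pos w) auto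
  then have c: "0 \<le> c" "c < 1" using \<epsilon> by (auto simp: c_def)
  have q: "0 \<le> q" "q < 1" using \<eta> by (auto simp: q_def)
  have deviates_meas: "{\<omega> \<in> space ?\<Omega>. load_deviates p w \<epsilon> A t \<omega>} \<in> sets ?\<Omega>" if "t \<in> {1..T}" for A t
  proof -
    have "(\<lambda>\<omega>. load w A (arrival \<omega>) t) \<in> borel_measurable ?\<Omega>"
      unfolding load_def
    proof (rule borel_measurable_sum)
      fix s assume "s \<in> {1..t}"
      then have "s \<in> {1..T}" using that by auto
      from measurable_compose[OF measurable_arrival[OF F this], of "\<lambda>i. if i \<in> A then w i else 0" borel]
      show "(\<lambda>\<omega>. if arrival \<omega> s \<in> A then w (arrival \<omega> s) else 0) \<in> borel_measurable ?\<Omega>" by simp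
    qed
    then show ?thesis unfolding load_deviates_def by measurable
  qed
  have misjudged_meas: "{\<omega> \<in> space ?\<Omega>. misjudged r \<eta> T j t \<omega>} \<in> sets ?\<Omega>" for j t
    unfolding misjudged_def using measurable_empirical_average[OF F, of T t j p] by measurable
  have deviates_prob: "(\<integral>\<omega>. of_bool (load_deviates p w \<epsilon> A t \<omega>) \<partial>?\<Omega>) \<le> 2 * c ^ t" if "t \<in> {1..T}" for A t
    using load_deviation[where w = w and t = t and T = T and \<epsilon> = \<epsilon> and p = p and A = A, OF F w] \<epsilon> that
    unfolding \<Omega>.integral_of_bool[OF deviates_meas[OF that]] by (simp add: load_deviates_def c_def)
  have misjudged_prob: "(\<integral>\<omega>. of_bool (misjudged r \<eta> T j t \<omega>) \<partial>?\<Omega>) \<le> 2 * (1 - pmf p j * (1 - q)) ^ (T - t)"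
    for j t
    using estimate_deviation[OF F, of \<eta> p T t j] \<eta>
    unfolding \<Omega>.integral_of_bool[OF misjudged_meas] by (simp add: misjudged_def q_def)
  note int = \<Omega>.integrable_of_bool[OF deviates_meas] \<Omega>.integrable_of_bool[OF misjudged_meas]
  have int_defects: "integrable ?\<Omega> (defects p r w \<epsilon> \<eta> t0 T t)" if "t \<in> {1..T}" for t
    unfolding defects_def[abs_def]
    using int that
    by (intro Bochner_Integration.integrable_add Bochner_Integration.integrable_sum) auto
  show "integrable ?\<Omega> (\<lambda>\<omega>. \<Sum>t=1..T. defects p r w \<epsilon> \<eta> t0 T t \<omega>)"
    using int_defects by (rule Bochner_Integration.integrable_sum)
  have mean_defects: "(\<integral>\<omega>. defects p r w \<epsilon> \<eta> t0 T t \<omega> \<partial>?\<Omega>) \<le> of_bool (t < t0)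
      + (real CARD('n) * 2) * c ^ t + (real CARD('n) * 2) * c ^ t
      + (\<Sum>j\<in>set_pmf p. 2 * (1 - pmf p j * (1 - q)) ^ (T - t))" if t: "t \<in> {1..T}" for t
  proof -
    let ?D1 = "\<lambda>j \<omega>. of_bool (load_deviates p w \<epsilon> (better r w j) t \<omega>) :: real"
    let ?D2 = "\<lambda>j \<omega>. of_bool (load_deviates p w \<epsilon> (at_least_as_good r w j) t \<omega>) :: real"
    let ?D3 = "\<lambda>j \<omega>. of_bool (misjudged r \<eta> T j t \<omega>) :: real"
    have i: "integrable ?\<Omega> (?D1 j)" "integrable ?\<Omega> (?D2 j)" "integrable ?\<Omega> (?D3 j)" for j
      using int(1)[OF t] int(2) by auto
    have "(\<integral>\<omega>. defects p r w \<epsilon> \<eta> t0 T t \<omega> \<partial>?\<Omega>) = of_bool (t < t0)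
        + (\<Sum>j\<in>UNIV. \<integral>\<omega>. ?D1 j \<omega> \<partial>?\<Omega>) + (\<Sum>j\<in>UNIV. \<integral>\<omega>. ?D2 j \<omega> \<partial>?\<Omega>)
        + (\<Sum>j\<in>set_pmf p. \<integral>\<omega>. ?D3 j \<omega> \<partial>?\<Omega>)"
      unfolding defects_def by (simp add: i \<Omega>.prob_space del: sum_of_bool_eq)
    also have "\<dots> \<le> of_bool (t < t0) + (\<Sum>j\<in>(UNIV :: 'n set). 2 * c ^ t) + (\<Sum>j\<in>(UNIV :: 'n set). 2 * c ^ t)
        + (\<Sum>j\<in>set_pmf p. 2 * (1 - pmf p j * (1 - q)) ^ (T - t))"
      using deviates_prob[OF t] misjudged_prob by (intro add_mono sum_mono order_refl) auto
    finally show ?thesis by simp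
  qed
  have "(\<integral>\<omega>. (\<Sum>t=1..T. defects p r w \<epsilon> \<eta> t0 T t \<omega>) \<partial>?\<Omega>)
      = (\<Sum>t=1..T. \<integral>\<omega>. defects p r w \<epsilon> \<eta> t0 T t \<omega> \<partial>?\<Omega>)"
    using int_defects by (rule Bochner_Integration.integral_sum)
  also have "\<dots> \<le> (\<Sum>t=1..T. of_bool (t < t0)
      + (real CARD('n) * 2) * c ^ t + (real CARD('n) * 2) * c ^ t
      + (\<Sum>j\<in>set_pmf p. 2 * (1 - pmf p j * (1 - q)) ^ (T - t)))"
    using mean_defects by (rule sum_mono)
  also have "\<dots> = (\<Sum>t=1..T. of_bool (t < t0)) + (real CARD('n) * 2) * (\<Sum>t=1..T. c ^ t)
      + (real CARD('n) * 2) * (\<Sum>t=1..T. c ^ t)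
      + (\<Sum>j\<in>set_pmf p. 2 * (\<Sum>t=1..T. (1 - pmf p j * (1 - q)) ^ (T - t)))"
    by (simp only: sum.distrib sum_distrib_left sum.swap[of _ "{1..T}" "set_pmf p"])
  also have "\<dots> \<le> real t0 + (real CARD('n) * 2) * (1 / (1 - c)) + (real CARD('n) * 2) * (1 / (1 - c))
      + (\<Sum>j\<in>set_pmf p. 2 * (1 / (1 - (1 - pmf p j * (1 - q)))))"
  proof (intro add_mono sum_mono mult_left_mono sum_power_le c)
    have "(\<Sum>t=1..T. of_bool (t < t0)) = real (card {t \<in> {1..T}. t < t0})"
      by (simp add: Int_def)
    also have "card {t \<in> {1..T}. t < t0} \<le> card {..<t0}" by (rule card_mono) auto
    finally show "(\<Sum>t=1..T. of_bool (t < t0)) \<le> real t0" by simp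
    fix j assume "j \<in> set_pmf p"
    then have "0 < pmf p j * (1 - q)" using q by (simp add: pmf_positive)
    then show "1 - pmf p j * (1 - q) < 1" by simp
    show "0 \<le> 1 - pmf p j * (1 - q)" using mult_le_one[OF pmf_le_1, of "1 - q" p j] q by simp
  qed auto
  also have "\<dots> = loss_bound p w \<epsilon> \<eta> t0"
    by (simp add: loss_bound_def Let_def c_def q_def)
  finally show "(\<integral>\<omega>. (\<Sum>t=1..T. defects p r w \<epsilon> \<eta> t0 T t \<omega>) \<partial>?\<Omega>) \<le> loss_bound p w \<epsilon> \<eta> t0" .
qed

text \<open>On almost every outcome Offline's mean rewards are bounded by the relaxation, and the relaxation by those
  of the policy plus the losses; the expectations follow.\<close>

lemma offline_le_rabbi:
  fixes p :: "'n::finite pmf" and r w :: "'n \<Rightarrow> real"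
  assumes F: "reward_distributions r F" and w: "\<And>j. 0 < w j" and B: "0 \<le> B"
    and \<eta>: "resolves r w \<eta>" and \<epsilon>_pos: "0 < \<epsilon>"
    and \<epsilon>: "\<And>j. j \<in> set_pmf p \<Longrightarrow> \<epsilon> \<le> w j * pmf p j / 4"
    and t0: "\<And>j. j \<in> set_pmf p \<Longrightarrow> 4 \<le> real t0 * pmf p j"
    and rabbi: "learning_rabbi p w T B \<pi>" and offline: "\<sigma> \<in> offline_policies w T B"
  shows "expected_reward p F T (offline_decision T \<sigma>)
    \<le> v_on p F T \<pi> + max_loss r w * loss_bound p w \<epsilon> \<eta> t0"
proof -
  let ?\<Omega> = "outcome_space p F T"
  let ?on = "\<lambda>\<omega>. \<Sum>t=1..T. if online_decision T \<pi> t \<omega> = Accept then r (arrival \<omega> t) else 0"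
  let ?off = "\<lambda>\<omega>. \<Sum>t=1..T. if offline_decision T \<sigma> t \<omega> = Accept then r (arrival \<omega> t) else 0"
  let ?lost = "\<lambda>\<omega>. \<Sum>t=1..T. defects p r w \<epsilon> \<eta> t0 T t \<omega>"
  have "0 < \<eta>" using \<eta> by (simp add: resolves_def)
  note lost = expected_defects[where p = p and T = T and ?t0.0 = t0, OF F w \<epsilon>_pos \<open>0 < \<eta>\<close>]
  have on_meas: "online_decision T \<pi> t \<in> measurable ?\<Omega> (count_space UNIV)" if t: "t \<in> {1..T}" for t
  proof -
    have "(\<lambda>\<omega>. (\<lambda>j\<in>UNIV. initial_sample \<omega> j, observed {t..T} {t<..T} \<omega>))
        \<in> measurable ?\<Omega> (PiM UNIV (\<lambda>_. borel) \<Otimes>\<^sub>M data_space {t..T} {t<..T})"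
      using t by (intro measurable_Pair measurable_restrict measurable_initial_sample[OF F] measurable_observed[OF F]) auto
    then show ?thesis
      using rabbi t measurable_compose unfolding learning_rabbi_def online_decision_def[abs_def] restrict_UNIV
      by blast
  qed
  have off_meas: "offline_decision T \<sigma> t \<in> measurable ?\<Omega> (count_space UNIV)" if t: "t \<in> {1..T}" for t
  proof -
    have "observed {1..T} {t<..T} \<in> measurable ?\<Omega> (data_space {1..T} {t<..T})"
      using t by (intro measurable_observed[OF F]) auto
    moreover have "\<sigma> t \<in> measurable (data_space {1..T} {t<..T}) (count_space UNIV)"
      using offline t by (simp add: offline_policies_def)
    ultimately show ?thesis unfolding offline_decision_def[abs_def] by (rule measurable_compose)
  qed
  have on_unseen: "online_decision T \<pi> t (i, a, y(t := v)) = online_decision T \<pi> t (i, a, y)" for t i a y v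
    by (simp add: online_decision_def observed_unseen initial_sample_def)
  have off_unseen: "offline_decision T \<sigma> t (i, a, y(t := v)) = offline_decision T \<sigma> t (i, a, y)" for t i a y v
    by (simp add: offline_decision_def observed_unseen)
  note on = expected_reward_eq_mean[where d = "online_decision T \<pi>", OF F on_meas on_unseen]
  note off = expected_reward_eq_mean[where d = "offline_decision T \<sigma>", OF F off_meas off_unseen]
  have pathwise: "?off \<omega> \<le> ?on \<omega> + max_loss r w * ?lost \<omega>"
    if "\<forall>t\<in>{1..T}. arrival \<omega> t \<in> set_pmf p" for \<omega>
  proof -
    have "?off \<omega> = (\<Sum>t=1..T. if t \<in> {t. offline_decision T \<sigma> t \<omega> = Accept} then r (arrival \<omega> t) else 0)"
      by simp
    also have "\<dots> \<le> relaxation r w B (arrival \<omega>) T"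
    proof (rule collected_le_relaxation[where w = w, OF w])
      have "offline_decision T \<sigma> t \<omega> \<in> feasible_actions w T B (offline_decision T \<sigma>) t \<omega>" if "t \<in> {1..T}" for t
        using offline that unfolding offline_policies_def by blast
      from feasible_within_budget[OF B this]
      show "(\<Sum>t | t \<in> {1..T} \<and> t \<in> {t. offline_decision T \<sigma> t \<omega> = Accept}. w (arrival \<omega> t)) \<le> B"
        by simp
    qed
    also have "\<dots> \<le> ?on \<omega> + max_loss r w * ?lost \<omega>"
      using that by (intro rabbi_pathwise[OF w \<eta> \<epsilon> t0 rabbi]) auto
    finally show ?thesis .
  qed
  have "(\<integral>\<omega>. ?off \<omega> \<partial>?\<Omega>) \<le> (\<integral>\<omega>. ?on \<omega> + max_loss r w * ?lost \<omega> \<partial>?\<Omega>)"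
  proof (rule integral_mono_AE)
    show "integrable ?\<Omega> ?off" by (rule off(1))
    show "integrable ?\<Omega> (\<lambda>\<omega>. ?on \<omega> + max_loss r w * ?lost \<omega>)"
      by (intro Bochner_Integration.integrable_add on(1) integrable_mult_right lost(1))
    show "AE \<omega> in ?\<Omega>. ?off \<omega> \<le> ?on \<omega> + max_loss r w * ?lost \<omega>"
      using AE_arrivals_in_support[where p = p and T = T, OF F] by (rule eventually_mono) (rule pathwise)
  qed
  also have "\<dots> = (\<integral>\<omega>. ?on \<omega> \<partial>?\<Omega>) + max_loss r w * (\<integral>\<omega>. ?lost \<omega> \<partial>?\<Omega>)"
    using on(1) lost(1) by (simp del: One_nat_def)
  also have "\<dots> \<le> (\<integral>\<omega>. ?on \<omega> \<partial>?\<Omega>) + max_loss r w * loss_bound p w \<epsilon> \<eta> t0"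
    using max_loss_bounds(2)[where w = w and r = r and j = undefined, OF w] lost(2)
    by (intro add_left_mono mult_left_mono) auto
  finally show ?thesis by (simp only: v_on_def on(2) off(2))
qed

text \<open>The supremum defining \<open>v_off\<close> ranges over a nonempty set.\<close>

lemma rejecting_is_offline_policy: "0 \<le> B \<Longrightarrow> (\<lambda>_ _. Reject) \<in> offline_policies w T B"
  by (simp add: offline_policies_def offline_decision_def feasible_actions_def)

theorem theorem4:
  fixes p :: "'n::finite pmf" and r w :: "'n \<Rightarrow> real"
  assumes "\<And>j. 0 < w j"
    and "0 < ratio_gap r w"
  shows "\<exists>M::real. \<forall>(F :: 'n \<Rightarrow> real measure) (T::nat) (B::real) (\<pi> :: 'n online_policy).
           reward_distributions r F \<longrightarrow> 0 \<le> B \<longrightarrow> learning_rabbi p w T B \<pi> \<longrightarrow>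
           v_off p w F T B - v_on p F T \<pi> \<le> M"
proof -
  obtain \<eta> where \<eta>: "resolves r w \<eta>" using resolves_exists[where r = r and w = w, OF assms(1)] by blast
  \<comment> \<open>The admissible load deviation per period, and a horizon beyond which every type is
    expected to arrive at least four times.\<close>
  define m where "m = Min ((\<lambda>j. w j * pmf p j / 4) ` set_pmf p)"
  have m_pos: "0 < m" using assms(1) by (simp add: m_def set_pmf_not_empty pmf_positive)
  have m_le: "m \<le> w j * pmf p j / 4" if "j \<in> set_pmf p" for j
    unfolding m_def using that by (intro Min_le) auto
  define l where "l = Min (pmf p ` set_pmf p)"
  have l: "0 < l" "\<And>j. j \<in> set_pmf p \<Longrightarrow> l \<le> pmf p j"
    by (auto simp: l_def set_pmf_not_empty pmf_positive)
  obtain t0 where "4 / l \<le> real t0" using real_arch_simple by blast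
  then have "4 \<le> real t0 * l" using l(1) by (simp add: pos_divide_le_eq)
  then have t0: "4 \<le> real t0 * pmf p j" if "j \<in> set_pmf p" for j
    using mult_left_mono[OF l(2)[OF that], of "real t0"] by linarith
  show ?thesis
  proof (intro exI[of _ "max_loss r w * loss_bound p w m \<eta> t0"] allI impI)
    fix F :: "'n \<Rightarrow> real measure" and T :: nat and B :: real and \<pi> :: "'n online_policy"
    assume F: "reward_distributions r F" and B: "0 \<le> B" and rabbi: "learning_rabbi p w T B \<pi>"
    have "v_off p w F T B \<le> v_on p F T \<pi> + max_loss r w * loss_bound p w m \<eta> t0"
      unfolding v_off_def
    proof (rule cSUP_least)
      show "offline_policies w T B \<noteq> {}" using rejecting_is_offline_policy[OF B] by blast
    qed (rule offline_le_rabbi[OF F assms(1) B \<eta> m_pos m_le t0 rabbi])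
    then show "v_off p w F T B - v_on p F T \<pi> \<le> max_loss r w * loss_bound p w m \<eta> t0" by simp
  qed
qed

end
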